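(* Assume that $v_1,v_2\in L^\infty(Q)\cap\bigcap_{p>1}W^{2,1}_{p,loc}(Q)$ both satisfy the initial condition: for every $K>0$, $$\lim_{t\to0}\ \sup_{|y|\le K,\,x\in\mathbb R}\Big|v_i(x,y,t)-\varphi\Big(\frac{x}{\nu\sqrt t}\Big)\Big|=0,\qquad i=1,2,$$ that $$\mathcal F[v_1]\ge\mathcal F[v_2]\quad\text{a.e. in }Q,$$ and that $$\max\Big\{\frac{\partial v_1}{\partial x},\frac{\partial v_2}{\partial x}\Big\}\ge0\quad\text{in }Q.$$ Then $v_1\ge v_2$ in $Q$.
   Context: $\sigma,\nu,\mu,r,m,T$ are positive constants with $\mu>r$. $\Omega=\mathbb R^2$ (points $(x,y)$), $Q=\Omega\times(0,T]$. Operators: $\mathcal L[\psi]=\psi_t-\frac{\sigma^2}{2}\psi_{yy}-\frac{\nu^2}{2}\psi_{xx}-(\mu+\frac12\sigma^2)\psi_y-(\mu-r)\psi$ and $$\mathcal F[\psi]=\max\Big\{\mathcal L[\psi]+\frac{e^y}{m}\psi\frac{\partial\psi}{\partial x},\ \psi-1\Big\}.$$ $W^{2,1}_{p,loc}(Q)$ is the local parabolic Sobolev space (two derivatives in $(x,y)$ and one in $t$, in $L^p_{loc}$); elements and their first $x$-derivatives are identified with their continuous representatives (large $p$). $\varphi(x)=\int_{-\infty}^x\frac1{\sqrt{2\pi}}e^{-u^2/2}\,du$. *)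

theory Defs
  imports "HOL-Analysis.Analysis"
begin

type_synonym pt = "real \<times> real \<times> real"  (* (x, y, t) *)

definition Q :: "real \<Rightarrow> pt set" where
  "Q T = {(x, y, t). 0 < t \<and> t \<le> T}"

abbreviation ex :: pt where "ex \<equiv> (1, 0, 0)"
abbreviation ey :: pt where "ey \<equiv> (0, 1, 0)"
abbreviation et :: pt where "et \<equiv> (0, 0, 1)"

definition dird :: "pt \<Rightarrow> (pt \<Rightarrow> real) \<Rightarrow> pt \<Rightarrow> real" where
  "dird e f = (\<lambda>z. frechet_derivative f (at z) e)"

primrec Ck :: "nat \<Rightarrow> (pt \<Rightarrow> real) \<Rightarrow> bool" where
  "Ck 0 f \<longleftrightarrow> continuous_on UNIV f"
| "Ck (Suc k) f \<longleftrightarrow> (\<forall>z. f differentiable (at z)) \<and> (\<forall>e\<in>Basis. Ck k (dird e f))"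

definition test_fun :: "pt set \<Rightarrow> (pt \<Rightarrow> real) \<Rightarrow> bool" where
  "test_fun S \<phi> \<longleftrightarrow> (\<forall>k. Ck k \<phi>) \<and> compact (closure {z. \<phi> z \<noteq> 0})
     \<and> closure {z. \<phi> z \<noteq> 0} \<subseteq> interior S"

definition Linfty :: "pt set \<Rightarrow> (pt \<Rightarrow> real) set" where
  "Linfty S = {f \<in> borel_measurable (lebesgue_on S). \<exists>C. AE z in lebesgue_on S. \<bar>f z\<bar> \<le> C}"

text \<open>Locality is with respect to compact subsets of \<open>S\<close>; for \<open>S = Q T\<close> such a set may touch
  the top \<open>t = T\<close>, but stays away from \<open>t = 0\<close>.\<close>

definition Lp_loc :: "real \<Rightarrow> pt set \<Rightarrow> (pt \<Rightarrow> real) set" where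
  "Lp_loc p S = {f \<in> borel_measurable (lebesgue_on S).
     \<forall>K. compact K \<and> K \<subseteq> S \<longrightarrow> integrable (lebesgue_on K) (\<lambda>z. \<bar>f z\<bar> powr p)}"

text \<open>\<open>has_weak_deriv S ds v g\<close>: in the interior of \<open>S\<close>, \<open>g\<close> is the distributional derivative of
  \<open>v\<close> in the directions listed in \<open>ds\<close> (with repetition).\<close>

definition has_weak_deriv :: "pt set \<Rightarrow> pt list \<Rightarrow> (pt \<Rightarrow> real) \<Rightarrow> (pt \<Rightarrow> real) \<Rightarrow> bool" where
  "has_weak_deriv S ds v g \<longleftrightarrow>
     v \<in> Lp_loc 1 (interior S) \<and> g \<in> Lp_loc 1 (interior S) \<and>
     (\<forall>\<phi>. test_fun S \<phi> \<longrightarrow>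
        (\<integral>z. v z * foldr dird ds \<phi> z \<partial>lebesgue_on (interior S))
          = (-1) ^ length ds * (\<integral>z. g z * \<phi> z \<partial>lebesgue_on (interior S)))"

text \<open>A weak derivative, if there is one, is unique up to null sets of the interior of \<open>S\<close>, and
  hence (the top \<open>t = T\<close> being a null set) up to null sets of \<open>S\<close> if \<open>S = Q T\<close>. So the choice
  below matters only on a null set.\<close>

definition wderiv :: "pt set \<Rightarrow> pt list \<Rightarrow> (pt \<Rightarrow> real) \<Rightarrow> pt \<Rightarrow> real" where
  "wderiv S ds v = (SOME g. has_weak_deriv S ds v g)"

definition W21_loc :: "real \<Rightarrow> pt set \<Rightarrow> (pt \<Rightarrow> real) set" where
  "W21_loc p S = {v \<in> Lp_loc p S.
     \<forall>ds \<in> {[ex], [ey], [ex, ex], [ex, ey], [ey, ey], [et]}.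
       (\<exists>g. has_weak_deriv S ds v g) \<and> wderiv S ds v \<in> Lp_loc p S}"

text \<open>\<open>g\<close> is the continuous representative on \<open>S\<close> of the a.e.-class of \<open>f\<close>; for \<open>S = Q T\<close> its
  values on \<open>S\<close> are uniquely determined.\<close>

definition cont_rep :: "pt set \<Rightarrow> (pt \<Rightarrow> real) \<Rightarrow> (pt \<Rightarrow> real) \<Rightarrow> bool" where
  "cont_rep S f g \<longleftrightarrow> continuous_on S g \<and> (AE z in lebesgue_on S. g z = f z)"

definition Lop :: "real \<Rightarrow> real \<Rightarrow> real \<Rightarrow> real \<Rightarrow> real \<Rightarrow> (pt \<Rightarrow> real) \<Rightarrow> pt \<Rightarrow> real" where
  "Lop \<sigma> \<nu> \<mu> r T \<psi> z =
     wderiv (Q T) [et] \<psi> z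
     - \<sigma>\<^sup>2 / 2 * wderiv (Q T) [ey, ey] \<psi> z
     - \<nu>\<^sup>2 / 2 * wderiv (Q T) [ex, ex] \<psi> z
     - (\<mu> + 1 / 2 * \<sigma>\<^sup>2) * wderiv (Q T) [ey] \<psi> z
     - (\<mu> - r) * \<psi> z"

definition Fop :: "real \<Rightarrow> real \<Rightarrow> real \<Rightarrow> real \<Rightarrow> real \<Rightarrow> real \<Rightarrow> (pt \<Rightarrow> real) \<Rightarrow> pt \<Rightarrow> real" where
  "Fop \<sigma> \<nu> \<mu> r m T \<psi> = (\<lambda>(x, y, t).
     max (Lop \<sigma> \<nu> \<mu> r T \<psi> (x, y, t)
            + exp y / m * \<psi> (x, y, t) * wderiv (Q T) [ex] \<psi> (x, y, t))
         (\<psi> (x, y, t) - 1))"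

definition ncdf :: "real \<Rightarrow> real" where
  "ncdf x = (LBINT u:{..x}. 1 / sqrt (2 * pi) * exp (- u\<^sup>2 / 2))"

text \<open>For \<open>v\<close> bounded on \<open>Q T\<close> the supremum is over a bounded set once \<open>0 < t \<le> T\<close>.\<close>

definition initial_cond :: "real \<Rightarrow> (pt \<Rightarrow> real) \<Rightarrow> bool" where
  "initial_cond \<nu> v \<longleftrightarrow> (\<forall>K>0.
     ((\<lambda>t. SUP (x, y) \<in> {(x, y). \<bar>y\<bar> \<le> K}. \<bar>v (x, y, t) - ncdf (x / (\<nu> * sqrt t))\<bar>)
        \<longlongrightarrow> 0) (at_right 0))"

end

theory Submission
  imports Defs "HOL-Probability.Distributions"
begin

text \<open>Where \<open>w = v\<^sub>2 - v\<^sub>1 > 0\<close>, the obstacle is inactive for \<open>v\<^sub>1\<close>, so \<open>w\<close> satisfies there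
  \<open>w\<^sub>t - a w\<^sub>y\<^sub>y - b w\<^sub>x\<^sub>x - c w\<^sub>y \<le> F\<close> weakly, with constant coefficients and a \<^emph>\<open>continuous\<close> right-hand
  side \<open>F\<close> (it involves only \<open>v\<^sub>i\<close> and \<open>\<partial>\<^sub>x v\<^sub>i\<close>). Because the coefficients are constant, mollification
  preserves this inequality and turns it into a pointwise inequality at every point where a smooth
  function touches \<open>w\<close> from above; no parabolic Alexandrov estimate is needed.

  If \<open>w\<close> were positive somewhere, then for \<open>\<kappa>\<close> large it would be touched from above at an interior
  point by \<open>e\<^bsup>\<kappa>t\<^esup> (M + \<epsilon> (x\<^sup>2 + e\<^bsup>2y\<^esup> + e\<^bsup>-2y\<^esup>) + \<eta> / (T - t))\<close> with \<open>M > 0\<close>. At that point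
  \<open>v\<^sub>2 \<partial>\<^sub>x v\<^sub>2 - v\<^sub>1 \<partial>\<^sub>x v\<^sub>1\<close> equals \<open>v\<^sub>1 w\<^sub>x + w \<partial>\<^sub>x v\<^sub>2 = v\<^sub>2 w\<^sub>x + w \<partial>\<^sub>x v\<^sub>1\<close>, and since one of the two
  \<open>x\<close>-derivatives is nonnegative it is at least \<open>- C \<bar>w\<^sub>x\<bar>\<close>. The barrier grows fast enough to absorb
  the resulting drift \<open>e\<^bsup>y\<^esup> \<bar>w\<^sub>x\<bar>\<close>, a contradiction.\<close>

section \<open>Smooth bump functions\<close>

text \<open>All smooth functions are given together with their sequence of derivatives.\<close>

definition smooth_seq :: "(nat \<Rightarrow> real \<Rightarrow> real) \<Rightarrow> bool" where
  "smooth_seq d \<longleftrightarrow> (\<forall>n s. (d n has_real_derivative d (Suc n) s) (at s))"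

text \<open>The powers of \<open>s\<close> in the denominator make the family stable under
  differentiation: each derivative is a combination of \<open>flat (k + 2)\<close> and
  \<open>flat (k + 1)\<close>.\<close>

definition flat :: "nat \<Rightarrow> real \<Rightarrow> real" where
  "flat k s = (if s > 0 then exp (- 1 / s) / s ^ k else 0)"

text \<open>From the right, the substitution \<open>u = 1 / s\<close> gives
  \<open>u ^ k / exp u\<close> as \<open>u\<close> tends to infinity; from the left the function is
  zero.\<close>

lemma flat_tendsto_0: "(flat k \<longlongrightarrow> 0) (at 0)"
proof -
  have "((\<lambda>x. (inverse x) ^ k / exp (inverse x)) \<longlongrightarrow> (0::real)) (at_right 0)"
    using filterlim_compose[OF tendsto_power_div_exp_0 filterlim_inverse_at_top_right] .
  then have r: "(flat k \<longlongrightarrow> 0) (at_right 0)"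
    by (rule Lim_transform_eventually)
      (auto simp: flat_def eventually_at_right_field exp_minus field_simps intro!: exI[of _ 1])
  have l: "(flat k \<longlongrightarrow> 0) (at_left 0)"
    by (rule Lim_transform_eventually[of "\<lambda>_. 0"])
      (auto simp: flat_def eventually_at_left_field intro!: exI[of _ "-1"])
  show ?thesis using l r by (simp add: filterlim_split_at)
qed

lemma flat_has_derivative:
  "(flat k has_real_derivative (flat (k + 2) s - real k * flat (k + 1) s)) (at s)"
proof -
  consider "s > 0" | "s < 0" | "s = 0" by linarith
  then show ?thesis
  proof cases
    case 1
    have "((\<lambda>s. exp (- 1 / s) / s ^ k) has_real_derivative
        (flat (k + 2) s - real k * flat (k + 1) s)) (at s)"
    proof -
      have "((\<lambda>s. exp (- 1 / s)) has_real_derivative exp (- 1 / s) / s ^ 2) (at s)"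
        using 1 by (auto intro!: derivative_eq_intros simp: field_simps power2_eq_square)
      from DERIV_divide[OF this DERIV_pow[of k s]]
      have "((\<lambda>s. exp (- 1 / s) / s ^ k) has_real_derivative
          (exp (- 1 / s) / s\<^sup>2 * s ^ k - exp (- 1 / s) * (real k * s ^ (k - Suc 0))) / (s ^ k * s ^ k)) (at s)"
        using 1 by simp
      moreover have "(exp (- 1 / s) / s\<^sup>2 * s ^ k - exp (- 1 / s) * (real k * s ^ (k - Suc 0))) / (s ^ k * s ^ k)
          = flat (k + 2) s - real k * flat (k + 1) s"
        using 1 by (cases k) (simp_all add: flat_def field_simps power2_eq_square)
      ultimately show ?thesis by simp
    qed
    then show ?thesis
      by (rule DERIV_cong_ev[THEN iffD1, rotated -1])
        (use 1 in \<open>auto simp: flat_def intro: eventually_mono[OF eventually_gt_at_top]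
          eventually_mono[OF eventually_nhds_in_open[of "{0<..}"]]\<close>)
  next
    case 2
    have "((\<lambda>s. 0) has_real_derivative (flat (k + 2) s - real k * flat (k + 1) s)) (at s)"
      using 2 by (simp add: flat_def)
    then show ?thesis
      by (rule DERIV_cong_ev[THEN iffD1, rotated -1])
        (use 2 in \<open>auto simp: flat_def intro: eventually_mono[OF eventually_nhds_in_open[of "{..<0}"]]\<close>)
  next
    case 3
    \<comment> \<open>The difference quotient of \<open>flat k\<close> at 0 is
      \<open>flat (k + 1)\<close>, which tends to 0.\<close>
    have "((\<lambda>h. (flat k (0 + h) - flat k 0) / h) \<longlongrightarrow> 0) (at 0)"
      by (rule Lim_transform_eventually[OF flat_tendsto_0[of "k + 1"]])
        (auto simp: flat_def eventually_at_filter)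
    then show ?thesis using 3 by (simp add: DERIV_def flat_def)
  qed
qed

text \<open>\<open>flat_seq n k\<close> is the \<open>n\<close>-th derivative of \<open>flat k\<close>. Peeling off the first derivative, rather than
  the last one, avoids a closed formula; likewise for \<open>mult_seq\<close>, where \<open>i\<close> and \<open>j\<close> count the
  derivatives already taken of the two factors.\<close>

primrec flat_seq :: "nat \<Rightarrow> nat \<Rightarrow> real \<Rightarrow> real" where
  "flat_seq 0 k = flat k"
| "flat_seq (Suc n) k = (\<lambda>s. flat_seq n (k + 2) s - real k * flat_seq n (k + 1) s)"

lemma smooth_seq_flat: "smooth_seq (\<lambda>n. flat_seq n k)"
proof -
  have "(flat_seq n k has_real_derivative flat_seq (Suc n) k s) (at s)" for n s
  proof (induction n arbitrary: k)
    case 0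
    then show ?case using flat_has_derivative by simp
  next
    case (Suc n)
    show ?case
      unfolding flat_seq.simps(2)[of n k] flat_seq.simps(2)[of "Suc n" k]
      by (intro DERIV_diff DERIV_cmult Suc)
  qed
  then show ?thesis by (simp add: smooth_seq_def)
qed

primrec mult_seq :: "(nat \<Rightarrow> real \<Rightarrow> real) \<Rightarrow> (nat \<Rightarrow> real \<Rightarrow> real)
    \<Rightarrow> nat \<Rightarrow> nat \<Rightarrow> nat \<Rightarrow> real \<Rightarrow> real" where
  "mult_seq f g 0 i j = (\<lambda>s. f i s * g j s)"
| "mult_seq f g (Suc n) i j = (\<lambda>s. mult_seq f g n (Suc i) j s + mult_seq f g n i (Suc j) s)"

lemma smooth_seq_mult:
  assumes "smooth_seq f" "smooth_seq g"
  shows "smooth_seq (\<lambda>n. mult_seq f g n i j)"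
proof -
  have "(mult_seq f g n i j has_real_derivative mult_seq f g (Suc n) i j s) (at s)" for n s
  proof (induction n arbitrary: i j)
    case 0
    show ?case using assms by (auto intro!: derivative_eq_intros simp: smooth_seq_def)
  next
    case (Suc n)
    show ?case
      unfolding mult_seq.simps(2)[of f g n i j] mult_seq.simps(2)[of f g "Suc n" i j]
      by (intro DERIV_add Suc)
  qed
  then show ?thesis by (simp add: smooth_seq_def)
qed

lemma smooth_seq_affine:
  assumes "smooth_seq f"
  shows "smooth_seq (\<lambda>n s. c ^ n * f n (b + c * s))"
  unfolding smooth_seq_def
proof (intro allI)
  fix n s
  have "(f n has_real_derivative f (Suc n) (b + c * s)) (at (b + c * s))"
    using assms by (simp add: smooth_seq_def)
  moreover have "((\<lambda>s. b + c * s) has_real_derivative c) (at s)"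
    by (auto intro!: derivative_eq_intros)
  ultimately have "((\<lambda>s. f n (b + c * s)) has_real_derivative f (Suc n) (b + c * s) * c) (at s)"
    by (rule DERIV_chain2)
  from DERIV_cmult[OF this, of "c ^ n"]
  show "((\<lambda>s. c ^ n * f n (b + c * s)) has_real_derivative c ^ Suc n * f (Suc n) (b + c * s)) (at s)"
    by (simp add: algebra_simps)
qed

text \<open>The product of \<open>flat 0 (h + s)\<close> and \<open>flat 0 (h - s)\<close> is
  positive exactly for \<open>s\<close> strictly between \<open>- h\<close> and
  \<open>h\<close>.\<close>

lemma bump_seq_exists:
  fixes h :: real
  assumes "h > 0"
  obtains d where "smooth_seq d" "\<And>s. d 0 s \<ge> 0" "d 0 0 > 0" "\<And>n s. h < \<bar>s\<bar> \<Longrightarrow> d n s = 0"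
proof -
  \<comment> \<open>The trivial factors \<open>1 ^ n\<close> and \<open>1 * s\<close> keep the form
    of \<open>smooth_seq_affine\<close>.\<close>
  define f where "f = (\<lambda>n s. 1 ^ n * flat_seq n 0 (h + 1 * s))"
  define g where "g = (\<lambda>n s. (- 1) ^ n * flat_seq n 0 (h + (- 1) * s))"
  define d where "d = (\<lambda>n. mult_seq f g n 0 0)"
  have d: "smooth_seq d"
    unfolding d_def f_def g_def by (intro smooth_seq_mult smooth_seq_affine smooth_seq_flat)
  have "d n s = 0" if "h < \<bar>s\<bar>" for n s
    using that
  proof (induction n arbitrary: s)
    case 0
    then show ?case by (auto simp: d_def f_def g_def flat_def)
  next
    case (Suc n)
    \<comment> \<open>By induction \<open>d n\<close> vanishes on the whole open set
      \<open>h < \<bar>s\<bar>\<close>, so its derivative vanishes there too.\<close>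
    have "(d n has_real_derivative 0) (at s)"
    proof (rule has_field_derivative_transform_within_open[of "\<lambda>_. 0" _ _ "{s. h < \<bar>s\<bar>}"])
      show "open {s. h < \<bar>s\<bar>}" by (intro open_Collect_less continuous_intros)
    qed (use Suc in auto)
    moreover have "(d n has_real_derivative d (Suc n) s) (at s)"
      using d by (simp add: smooth_seq_def)
    ultimately show ?case using DERIV_unique by blast
  qed
  moreover have "d 0 s \<ge> 0" for s
    by (simp add: d_def f_def g_def flat_def)
  moreover have "d 0 0 > 0"
    using assms by (simp add: d_def f_def g_def flat_def)
  ultimately show thesis using that d by blast
qed

section \<open>Test functions in product form\<close>

definition tens :: "(real \<Rightarrow> real) \<Rightarrow> (real \<Rightarrow> real) \<Rightarrow> (real \<Rightarrow> real) \<Rightarrow> pt \<Rightarrow> real" where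
  "tens f g k = (\<lambda>(x, y, t). f x * g y * k t)"

lemma tens_has_derivative:
  assumes "(f has_real_derivative f') (at x)" "(g has_real_derivative g') (at y)"
    "(k has_real_derivative k') (at t)"
  shows "(tens f g k has_derivative
      (\<lambda>(a, b, c). a * f' * g y * k t + f x * (b * g') * k t + f x * g y * (c * k'))) (at (x, y, t))"
proof -
  have "((\<lambda>z. f (fst z)) has_derivative (\<lambda>h. fst h * f')) (at (x, y, t))"
    "((\<lambda>z. g (fst (snd z))) has_derivative (\<lambda>h. fst (snd h) * g')) (at (x, y, t))"
    "((\<lambda>z. k (snd (snd z))) has_derivative (\<lambda>h. snd (snd h) * k')) (at (x, y, t))"
    by (rule DERIV_compose_FDERIV; use assms in \<open>auto intro!: derivative_eq_intros\<close>)+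
  from has_derivative_mult[OF has_derivative_mult[OF this(1,2)] this(3)]
  show ?thesis
    by (rule has_derivative_eq_rhs[THEN back_subst[of "\<lambda>f. (f has_derivative _) _"]])
      (auto simp: tens_def fun_eq_iff algebra_simps)
qed

lemma tens_differentiable:
  assumes "smooth_seq f" "smooth_seq g" "smooth_seq k"
  shows "tens (f i) (g j) (k l) differentiable (at z)"
proof (cases z)
  case (fields x y t)
  then show ?thesis
    using tens_has_derivative[of "f i" _ x "g j" _ y "k l" _ t] assms
    unfolding smooth_seq_def differentiable_def by blast
qed

text \<open>Partial derivatives stay in the same family and only raise one index. This turns
  \<open>Ck n\<close> for every \<open>n\<close> into an induction over arbitrary indices.\<close>

lemma dird_tens:
  assumes "smooth_seq f" "smooth_seq g" "smooth_seq k"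
  shows "dird ex (tens (f i) (g j) (k l)) = tens (f (Suc i)) (g j) (k l)"
    "dird ey (tens (f i) (g j) (k l)) = tens (f i) (g (Suc j)) (k l)"
    "dird et (tens (f i) (g j) (k l)) = tens (f i) (g j) (k (Suc l))"
proof -
  have "dird e (tens (f i) (g j) (k l)) (x, y, t) = (\<lambda>(a, b, c). a * f (Suc i) x * g j y * k l t
      + f i x * (b * g (Suc j) y) * k l t + f i x * g j y * (c * k (Suc l) t)) e" for e x y t
    unfolding dird_def
    by (subst frechet_derivative_at[OF tens_has_derivative, symmetric])
      (use assms in \<open>auto simp: smooth_seq_def\<close>)
  then show "dird ex (tens (f i) (g j) (k l)) = tens (f (Suc i)) (g j) (k l)"
    "dird ey (tens (f i) (g j) (k l)) = tens (f i) (g (Suc j)) (k l)"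
    "dird et (tens (f i) (g j) (k l)) = tens (f i) (g j) (k (Suc l))"
    by (auto simp: fun_eq_iff tens_def)
qed

lemma Basis_pt: "(Basis :: pt set) = {ex, ey, et}"
  by (auto simp: Basis_prod_def zero_prod_def)

lemma continuous_on_tens:
  assumes "smooth_seq f" "smooth_seq g" "smooth_seq k"
  shows "continuous_on A (tens (f i) (g j) (k l))"
  by (intro continuous_at_imp_continuous_on ballI differentiable_imp_continuous_within
      tens_differentiable[OF assms])

lemma Ck_tens:
  assumes "smooth_seq f" "smooth_seq g" "smooth_seq k"
  shows "Ck n (tens (f i) (g j) (k l))"
proof (induction n arbitrary: i j l)
  case 0
  show ?case using continuous_on_tens[OF assms] by simp
next
  case (Suc n)
  then show ?case
    using tens_differentiable[OF assms] by (simp add: Basis_pt dird_tens[OF assms])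
qed

lemma test_fun_tens:
  assumes "smooth_seq f" "smooth_seq g" "smooth_seq k" and "cbox a b \<subseteq> interior S"
    and "\<And>z. z \<notin> cbox a b \<Longrightarrow> tens (f i) (g j) (k l) z = 0"
  shows "test_fun S (tens (f i) (g j) (k l))"
proof -
  have "closure {z. tens (f i) (g j) (k l) z \<noteq> 0} \<subseteq> cbox a b"
    using assms(5) by (intro closure_minimal) (auto intro: closed_cbox)
  moreover from this have "compact (closure {z. tens (f i) (g j) (k l) z \<noteq> 0})"
    by (meson bounded_cbox bounded_subset closed_closure compact_eq_bounded_closed)
  ultimately show ?thesis
    unfolding test_fun_def using assms(4) Ck_tens[OF assms(1-3)] by blast
qed

section \<open>Integrals of compactly supported products\<close>

lemma Lp_loc_mult_integrable:
  assumes S: "open S" and f: "f \<in> Lp_loc 1 S" and q: "continuous_on UNIV q"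
    and K: "compact K" "K \<subseteq> S" "\<And>z. z \<notin> K \<Longrightarrow> q z = 0"
  shows "integrable (lebesgue_on S) (\<lambda>z. f z * q z)"
proof -
  have Sm: "S \<in> sets lebesgue" and Km: "K \<in> sets lebesgue"
    using S K(1) by (auto simp: borel_open compact_imp_closed borel_closed)
  have fm: "f \<in> borel_measurable (lebesgue_on S)" using f by (simp add: Lp_loc_def)
  have fq: "(\<lambda>z. f z * q z) \<in> borel_measurable (lebesgue_on S)"
    using q by (intro borel_measurable_times fm)
      (metis Sm continuous_imp_measurable_on_sets_lebesgue continuous_on_subset subset_UNIV)
  obtain B where B: "\<And>z. z \<in> K \<Longrightarrow> \<bar>q z\<bar> \<le> B"
    using compact_imp_bounded[OF compact_continuous_image[OF continuous_on_subset[OF q] K(1)]]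
    by (auto simp: bounded_iff)
  have "integrable (lebesgue_on K) (\<lambda>z. \<bar>f z\<bar>)"
    using f K by (auto simp: Lp_loc_def)
  then have i: "integrable (lebesgue_on K) (\<lambda>z. B * \<bar>f z\<bar>)" by simp
  have "integrable (lebesgue_on K) (\<lambda>z. f z * q z)"
  proof (rule Bochner_Integration.integrable_bound[OF i])
    show "(\<lambda>z. f z * q z) \<in> borel_measurable (lebesgue_on K)"
      using fq K(2) measurable_restrict_mono by blast
    show "AE z in lebesgue_on K. norm (f z * q z) \<le> norm (B * \<bar>f z\<bar>)"
    proof (rule AE_I2)
      fix z assume "z \<in> space (lebesgue_on K)"
      then have "\<bar>q z\<bar> \<le> B" using B by simp
      then show "norm (f z * q z) \<le> norm (B * \<bar>f z\<bar>)"
        using mult_left_mono[of "\<bar>q z\<bar>" B "\<bar>f z\<bar>"] by (simp add: abs_mult mult.commute)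
    qed
  qed
  then have "integrable lebesgue (\<lambda>z. indicator K z *\<^sub>R (f z * q z))"
    using Km by (simp add: integrable_restrict_space)
  moreover have "(\<lambda>z. indicator K z *\<^sub>R (f z * q z)) = (\<lambda>z. indicator S z *\<^sub>R (f z * q z))"
    using K by (auto simp: fun_eq_iff indicator_def)
  ultimately show ?thesis using Sm by (simp add: integrable_restrict_space)
qed

text \<open>A bridge between two integrals: \<open>has_weak_deriv\<close> uses the Bochner integral
  over an open set, while mollification uses the gauge integral over a box, where the Leibniz rule
  is applied.\<close>

lemma lebesgue_integral_eq_cbox_integral:
  fixes q :: "pt \<Rightarrow> real"
  assumes "open S" "cbox a b \<subseteq> S" and "continuous_on (cbox a b) q" and "\<And>z. z \<notin> cbox a b \<Longrightarrow> q z = 0"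
  shows "integral\<^sup>L (lebesgue_on S) q = integral (cbox a b) q" "integrable (lebesgue_on S) q"
proof -
  have Sm: "S \<in> sets lebesgue" using assms(1) by (auto simp: borel_open)
  have "integrable (lebesgue_on (cbox a b)) q"
    using assms(3) by (metis compact_cbox continuous_imp_integrable)
  then have "integrable lebesgue (\<lambda>z. indicator (cbox a b) z *\<^sub>R q z)"
    by (simp add: integrable_restrict_space)
  moreover have "(\<lambda>z. indicator (cbox a b) z *\<^sub>R q z) = (\<lambda>z. indicator S z *\<^sub>R q z)"
    using assms by (auto simp: fun_eq_iff indicator_def)
  ultimately show i: "integrable (lebesgue_on S) q"
    using Sm by (simp add: integrable_restrict_space)
  have "(q has_integral integral (cbox a b) q) S"
    using assms(2-4) by (intro has_integral_on_superset[OF integrable_integral] integrable_continuous)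
  then show "integral\<^sup>L (lebesgue_on S) q = integral (cbox a b) q"
    using lebesgue_integral_eq_integral[OF i Sm] integral_unique by metis
qed

section \<open>Mollification\<close>

text \<open>A box instead of a ball, because the mollifier is a product of one-dimensional
  bumps.\<close>

definition cube :: "real \<Rightarrow> pt \<Rightarrow> pt set" where
  "cube h z = cbox (z - (h, h, h)) (z + (h, h, h))"

lemma mem_cube:
  "(a, b, c) \<in> cube h (x, y, t) \<longleftrightarrow> \<bar>a - x\<bar> \<le> h \<and> \<bar>b - y\<bar> \<le> h \<and> \<bar>c - t\<bar> \<le> h"
  by (auto simp: cube_def cbox_Pair_eq abs_le_iff)

lemma dist_cube: "\<zeta> \<in> cube h z \<Longrightarrow> dist \<zeta> z \<le> 3 * h"
proof (cases \<zeta>; cases z)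
  fix a b c x y t
  assume "\<zeta> \<in> cube h z" "\<zeta> = (a, b, c)" "z = (x, y, t)"
  moreover have "norm (a - x, b - y, c - t) \<le> \<bar>a - x\<bar> + (\<bar>b - y\<bar> + \<bar>c - t\<bar>)"
    using norm_Pair_le[of "a - x" "(b - y, c - t)"] norm_Pair_le[of "b - y" "c - t"] by simp
  ultimately show ?thesis by (simp add: mem_cube dist_norm)
qed

text \<open>The mass is not normalised to one; it is divided out where averages are formed.\<close>

definition bump :: "real \<Rightarrow> (nat \<Rightarrow> real \<Rightarrow> real) \<Rightarrow> bool" where
  "bump h d \<longleftrightarrow> h > 0 \<and> smooth_seq d \<and> (\<forall>s. d 0 s \<ge> 0) \<and> d 0 0 > 0 \<and> (\<forall>n s. h < \<bar>s\<bar> \<longrightarrow> d n s = 0)"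

definition kern :: "(nat \<Rightarrow> real \<Rightarrow> real) \<Rightarrow> nat \<Rightarrow> nat \<Rightarrow> nat \<Rightarrow> pt \<Rightarrow> pt \<Rightarrow> real" where
  "kern d i j k = (\<lambda>(x, y, t). tens (\<lambda>s. d i (s - x)) (\<lambda>s. d j (s - y)) (\<lambda>s. d k (s - t)))"

lemma smooth_seq_shift: "smooth_seq d \<Longrightarrow> smooth_seq (\<lambda>n s. d n (s - x))"
  using smooth_seq_affine[of d 1 "- x"] by simp

lemma smooth_seq_continuous: "smooth_seq d \<Longrightarrow> continuous_on A (d n)"
  by (rule DERIV_continuous_on[of _ _ "d (Suc n)"])
    (simp add: smooth_seq_def has_field_derivative_at_within)

lemma kern_outside:
  assumes "bump h d" "\<zeta> \<notin> cube h z"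
  shows "kern d i j k z \<zeta> = 0"
  using assms by (cases z; cases \<zeta>) (auto simp: kern_def tens_def mem_cube bump_def not_le)

lemma kern_nonneg: "bump h d \<Longrightarrow> 0 \<le> kern d 0 0 0 z \<zeta>"
  by (cases z; cases \<zeta>) (simp add: kern_def tens_def bump_def)

lemma continuous_on_kern_pair:
  assumes "smooth_seq d"
  shows "continuous_on A (\<lambda>(z, \<zeta>). kern d i j k z \<zeta>)"
proof -
  note c = continuous_on_compose2[OF smooth_seq_continuous[OF assms, of UNIV]]
  show ?thesis
    unfolding kern_def tens_def split_beta by (intro continuous_intros c) auto
qed

lemma continuous_on_kern: "smooth_seq d \<Longrightarrow> continuous_on A (kern d i j k z)"
  using continuous_on_compose2[OF continuous_on_kern_pair[of d UNIV]
      continuous_on_Pair[OF continuous_on_const[of A z] continuous_on_id]] by simp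

text \<open>The indices count derivatives of the kernel in the integration variable, so each derivative in
  \<open>z\<close> costs a sign.\<close>

definition conv :: "(nat \<Rightarrow> real \<Rightarrow> real) \<Rightarrow> pt \<Rightarrow> pt \<Rightarrow> (pt \<Rightarrow> real) \<Rightarrow> nat \<Rightarrow> nat \<Rightarrow> nat \<Rightarrow> pt \<Rightarrow> real" where
  "conv d l u w i j k z = integral (cbox l u) (\<lambda>\<zeta>. w \<zeta> * kern d i j k z \<zeta>)"

lemma continuous_on_conv_integrand:
  assumes "smooth_seq d" "continuous_on (cbox l u) w"
  shows "continuous_on (A \<times> cbox l u) (\<lambda>(z, \<zeta>). w \<zeta> * kern d i j k z \<zeta>)"
  using continuous_on_kern_pair[OF assms(1)] unfolding split_beta
  by (intro continuous_intros continuous_on_compose2[OF assms(2)]) auto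

lemma continuous_on_conv:
  assumes "smooth_seq d" "continuous_on (cbox l u) w"
  shows "continuous_on A (conv d l u w i j k)"
  unfolding conv_def using continuous_on_conv_integrand[OF assms]
  by (rule integral_continuous_on_param)

text \<open>Differentiation under the integral puts every derivative on the kernel, so continuity of
  \<open>w\<close> suffices.\<close>

lemma conv_has_derivative:
  assumes d: "smooth_seq d" and w: "continuous_on (cbox l u) w"
  shows "((\<lambda>s. conv d l u w i j k (s, y, t)) has_real_derivative - conv d l u w (Suc i) j k (x, y, t)) (at x)"
    "((\<lambda>s. conv d l u w i j k (x, s, t)) has_real_derivative - conv d l u w i (Suc j) k (x, y, t)) (at y)"
    "((\<lambda>s. conv d l u w i j k (x, y, s)) has_real_derivative - conv d l u w i j (Suc k) (x, y, t)) (at t)"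
proof -
  have dn: "((\<lambda>s. d n (c - s)) has_real_derivative - d (Suc n) (c - s)) (at s)" for n c s
  proof -
    have "(d n has_real_derivative d (Suc n) (c - s)) (at (c - s))"
      using d by (simp add: smooth_seq_def)
    moreover have "((\<lambda>s. c - s) has_real_derivative - 1) (at s)"
      by (auto intro!: derivative_eq_intros)
    ultimately show ?thesis using DERIV_chain2 by fastforce
  qed
  \<comment> \<open>The three directions are treated at once: \<open>g\<close> is the line along
    which the centre of the kernel moves.\<close>
  have gen: "((\<lambda>s. integral (cbox l u) (\<lambda>\<zeta>. w \<zeta> * K (g s) \<zeta>)) has_real_derivative
      - integral (cbox l u) (\<lambda>\<zeta>. w \<zeta> * K' (g s0) \<zeta>)) (at s0)"
    if K: "\<And>s \<zeta>. ((\<lambda>s. K (g s) \<zeta>) has_real_derivative - K' (g s) \<zeta>) (at s)"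
      and c: "\<And>A. continuous_on (A \<times> cbox l u) (\<lambda>(z, \<zeta>). w \<zeta> * K' z \<zeta>)"
      and c': "\<And>z. continuous_on (cbox l u) (K z)"
      and g: "continuous_on UNIV g"
    for K K' :: "pt \<Rightarrow> pt \<Rightarrow> real" and g :: "real \<Rightarrow> pt" and s0
  proof -
    have "((\<lambda>s. integral (cbox l u) (\<lambda>\<zeta>. w \<zeta> * K (g s) \<zeta>)) has_real_derivative
      integral (cbox l u) (\<lambda>\<zeta>. - (w \<zeta> * K' (g s0) \<zeta>))) (at s0)"
    proof (rule leibniz_rule_field_derivative[where U = UNIV and fx = "\<lambda>s \<zeta>. - (w \<zeta> * K' (g s) \<zeta>)"])
      show "((\<lambda>s. w \<zeta> * K (g s) \<zeta>) has_real_derivative - (w \<zeta> * K' (g s) \<zeta>)) (at s)" for s \<zeta>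
        using DERIV_cmult[OF K, of "w \<zeta>"] by simp
      show "(\<lambda>\<zeta>. w \<zeta> * K (g s) \<zeta>) integrable_on cbox l u" for s
        by (intro integrable_continuous continuous_intros w c')
      have "continuous_on (UNIV \<times> cbox l u) (\<lambda>p. case (g (fst p), snd p) of (z, \<zeta>) \<Rightarrow> w \<zeta> * K' z \<zeta>)"
        by (rule continuous_on_compose2[OF c[of UNIV]])
          (auto intro!: continuous_intros continuous_on_compose2[OF g])
      then show "continuous_on (UNIV \<times> cbox l u) (\<lambda>(s, \<zeta>). - (w \<zeta> * K' (g s) \<zeta>))"
        by (simp add: split_beta continuous_on_minus)
    qed auto
    then show ?thesis by simp
  qed
  show "((\<lambda>s. conv d l u w i j k (s, y, t)) has_real_derivative - conv d l u w (Suc i) j k (x, y, t)) (at x)"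
    unfolding conv_def
    by (rule gen[where K = "kern d i j k" and K' = "kern d (Suc i) j k" and g = "\<lambda>s. (s, y, t)",
          OF _ continuous_on_conv_integrand[OF d w] continuous_on_kern[OF d]])
      (auto simp: kern_def tens_def split_beta intro!: dn derivative_eq_intros continuous_on_Pair)
  show "((\<lambda>s. conv d l u w i j k (x, s, t)) has_real_derivative - conv d l u w i (Suc j) k (x, y, t)) (at y)"
    unfolding conv_def
    by (rule gen[where K = "kern d i j k" and K' = "kern d i (Suc j) k" and g = "\<lambda>s. (x, s, t)",
          OF _ continuous_on_conv_integrand[OF d w] continuous_on_kern[OF d]])
      (auto simp: kern_def tens_def split_beta intro!: dn derivative_eq_intros continuous_on_Pair)
  show "((\<lambda>s. conv d l u w i j k (x, y, s)) has_real_derivative - conv d l u w i j (Suc k) (x, y, t)) (at t)"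
    unfolding conv_def
    by (rule gen[where K = "kern d i j k" and K' = "kern d i j (Suc k)" and g = "\<lambda>s. (x, y, s)",
          OF _ continuous_on_conv_integrand[OF d w] continuous_on_kern[OF d]])
      (auto simp: kern_def tens_def split_beta intro!: dn derivative_eq_intros continuous_on_Pair)
qed

text \<open>A continuous nonnegative function with zero integral over the cube would vanish at its
  centre, where the kernel is positive.\<close>

lemma kern_mass_pos:
  assumes "bump h d"
  shows "0 < integral (cube h 0) (kern d 0 0 0 0)"
proof -
  let ?I = "integral (cube h 0) (kern d 0 0 0 0)"
  have h: "h > 0" and d: "smooth_seq d" using assms by (auto simp: bump_def)
  have z: "(0::pt) \<in> cbox (- (h, h, h)) (h, h, h)"
    using h by (simp add: zero_prod_def cbox_Pair_eq)
  have ne: "box (- (h, h, h)) (h, h, h) \<noteq> ({} :: pt set)"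
    using h by (auto simp: box_eq_empty Basis_pt not_le)
  have "?I \<noteq> 0"
  proof
    assume "?I = 0"
    then have "kern d 0 0 0 0 0 = 0"
      using integral_cbox_eq_0_iff[OF continuous_on_kern[OF d] ne kern_nonneg[OF assms]] z
      by (simp add: cube_def)
    then show False using assms by (simp add: kern_def tens_def zero_prod_def bump_def)
  qed
  moreover have "0 \<le> ?I"
    unfolding cube_def
    by (intro integral_nonneg integrable_continuous continuous_on_kern d kern_nonneg[OF assms])
  ultimately show ?thesis by simp
qed

text \<open>By translation invariance the mass does not depend on the centre \<open>z\<close>, so
  dividing by it commutes with derivatives in \<open>z\<close>.\<close>

lemma conv_one:
  assumes "bump h d" "cube h z \<subseteq> cbox l u"
  shows "conv d l u (\<lambda>_. 1) 0 0 0 z = integral (cube h 0) (kern d 0 0 0 0)"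
proof -
  let ?K = "kern d 0 0 0"
  have d: "smooth_seq d" using assms by (simp add: bump_def)
  have "(?K 0 has_integral integral (cube h 0) (?K 0)) (cbox (0 - (h, h, h)) (0 + (h, h, h)))"
    unfolding cube_def by (intro integrable_integral integrable_continuous continuous_on_kern d)
  from has_integral_shift_cbox[OF this, of "- z"]
  have "((\<lambda>\<zeta>. ?K 0 (\<zeta> - z)) has_integral integral (cube h 0) (?K 0)) (cube h z)"
    by (simp add: cube_def add.commute[of z] del: uminus_Pair)
  moreover have "(\<lambda>\<zeta>. ?K 0 (\<zeta> - z)) = ?K z"
    by (cases z) (auto simp: kern_def tens_def zero_prod_def)
  ultimately have "(?K z has_integral integral (cube h 0) (?K 0)) (cube h z)"
    by simp
  from has_integral_on_superset[OF this kern_outside[OF assms(1)] assms(2)]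
  show ?thesis by (simp add: conv_def integral_unique)
qed

text \<open>The normalised mollification is a mean with nonnegative weights supported in the cube,
  so it inherits any bound on the oscillation there.\<close>

lemma conv_average:
  assumes "bump h d" "cube h z \<subseteq> cbox l u" and q: "continuous_on (cbox l u) q"
    and "\<And>\<zeta>. \<zeta> \<in> cube h z \<Longrightarrow> \<bar>q \<zeta> - v\<bar> \<le> e"
  shows "\<bar>conv d l u q 0 0 0 z / integral (cube h 0) (kern d 0 0 0 0) - v\<bar> \<le> e"
proof -
  define N where "N = integral (cube h 0) (kern d 0 0 0 0)"
  let ?K = "kern d 0 0 0 z"
  have N: "N > 0" unfolding N_def by (rule kern_mass_pos[OF assms(1)])
  have d: "smooth_seq d" using assms by (simp add: bump_def)
  have one: "integral (cbox l u) ?K = N"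
    using conv_one[OF assms(1,2)] by (simp add: conv_def N_def)
  have Ki: "?K integrable_on cbox l u" "(\<lambda>\<zeta>. q \<zeta> * ?K \<zeta>) integrable_on cbox l u"
    by (intro integrable_continuous continuous_intros continuous_on_kern d q)+
  have "conv d l u q 0 0 0 z - v * N = integral (cbox l u) (\<lambda>\<zeta>. q \<zeta> * ?K \<zeta> - v * ?K \<zeta>)"
    unfolding conv_def using integral_diff[OF Ki(2) integrable_on_mult_right[OF Ki(1), of v]] one by simp
  moreover have "norm (integral (cbox l u) (\<lambda>\<zeta>. q \<zeta> * ?K \<zeta> - v * ?K \<zeta>))
      \<le> integral (cbox l u) (\<lambda>\<zeta>. e * ?K \<zeta>)"
  proof (rule integral_norm_bound_integral)
    show "norm (q \<zeta> * ?K \<zeta> - v * ?K \<zeta>) \<le> e * ?K \<zeta>" for \<zeta>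
    proof (cases "\<zeta> \<in> cube h z")
      case True
      from mult_right_mono[OF assms(4)[OF this] kern_nonneg[OF assms(1), of z \<zeta>]]
      show ?thesis using kern_nonneg[OF assms(1), of z \<zeta>]
        by (simp add: abs_mult flip: left_diff_distrib)
    qed (use kern_outside[OF assms(1)] in simp)
  qed (use Ki in \<open>auto intro!: integrable_diff integrable_on_mult_right\<close>)
  ultimately have "\<bar>conv d l u q 0 0 0 z - v * N\<bar> \<le> e * N"
    by (simp add: one)
  then show ?thesis
    using N unfolding N_def[symmetric] by (simp add: abs_le_iff field_simps)
qed

text \<open>If \<open>D\<close> were positive, \<open>f'\<close> would be positive just to the right
  of its zero \<open>x\<close>, and by the mean value theorem \<open>f\<close> would exceed its
  maximum. Only differentiability of \<open>f'\<close> at \<open>x\<close> itself enters.\<close>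

lemma local_max_derivs:
  fixes f f' :: "real \<Rightarrow> real"
  assumes r: "r > 0" and f: "\<And>s. \<bar>s - x\<bar> < r \<Longrightarrow> (f has_real_derivative f' s) (at s)"
    and f2: "(f' has_real_derivative D) (at x)"
    and max: "\<And>s. \<bar>s - x\<bar> < r \<Longrightarrow> f s \<le> f x"
  shows "f' x = 0" "D \<le> 0"
proof -
  show 0: "f' x = 0"
  proof (rule DERIV_local_max[OF _ r])
    show "(f has_real_derivative f' x) (at x)" using f r by simp
    show "\<forall>s. \<bar>x - s\<bar> < r \<longrightarrow> f s \<le> f x" using max by (simp add: abs_minus_commute)
  qed
  show "D \<le> 0"
  proof (rule ccontr)
    assume "\<not> D \<le> 0"
    then obtain e where e: "e > 0" "\<And>h. 0 < h \<Longrightarrow> h < e \<Longrightarrow> f' x < f' (x + h)"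
      using DERIV_pos_inc_right[OF f2] by auto
    define s where "s = min e r / 2"
    have s: "0 < s" "s < e" "s < r" using e r by (auto simp: s_def min_def)
    obtain c where c: "x < c" "c < x + s" "f (x + s) - f x = (x + s - x) * f' c"
      using MVT2[of x "x + s" f f'] f s by (auto simp: abs_if)
    have "f' c > 0" using e(2)[of "c - x"] c s 0 by simp
    then have "f (x + s) - f x > 0" unfolding c(3) using s by simp
    then show False using max[of "x + s"] s by auto
  qed
qed

section \<open>Touching a weak subsolution from above\<close>

text \<open>The mollification of \<open>w\<close>, minus \<open>\<psi>\<close>, attains its maximum over a small ball at an interior
  point \<open>z1\<close>; the classical conditions there pass to the limit since \<open>z1\<close> and the support of
  the kernel shrink to \<open>z0\<close>.\<close>

lemma strict_touching:
  fixes w p F \<psi> \<psi>t \<psi>x \<psi>y \<psi>xx \<psi>yy :: "pt \<Rightarrow> real"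
  assumes ab: "0 \<le> a" "0 \<le> b" and z0: "z0 \<in> box l u"
    and w: "continuous_on (cbox l u) w" and p: "continuous_on (cbox l u) p"
    and F: "continuous_on (cbox l u) F" and \<psi>: "continuous_on (box l u) \<psi>"
    and \<psi>x: "continuous_on (box l u) \<psi>x"
    and L\<psi>: "continuous_on (box l u) (\<lambda>z. \<psi>t z - a * \<psi>yy z - b * \<psi>xx z - c * \<psi>y z)"
    and deriv: "\<And>x y t. (x, y, t) \<in> box l u \<Longrightarrow>
        ((\<lambda>s. \<psi> (s, y, t)) has_real_derivative \<psi>x (x, y, t)) (at x) \<and>
        ((\<lambda>s. \<psi>x (s, y, t)) has_real_derivative \<psi>xx (x, y, t)) (at x) \<and>
        ((\<lambda>s. \<psi> (x, s, t)) has_real_derivative \<psi>y (x, y, t)) (at y) \<and>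
        ((\<lambda>s. \<psi>y (x, s, t)) has_real_derivative \<psi>yy (x, y, t)) (at y) \<and>
        ((\<lambda>s. \<psi> (x, y, s)) has_real_derivative \<psi>t (x, y, t)) (at t)"
    and strict: "\<And>z. z \<in> box l u \<Longrightarrow> z \<noteq> z0 \<Longrightarrow> w z - \<psi> z < w z0 - \<psi> z0"
    and weak: "\<And>h d z. bump h d \<Longrightarrow> cube h z \<subseteq> cbox l u \<Longrightarrow>
        conv d l u p 0 0 0 z = - conv d l u w 1 0 0 z \<and>
        - conv d l u w 0 0 1 z - a * conv d l u w 0 2 0 z - b * conv d l u w 2 0 0 z
          + c * conv d l u w 0 1 0 z \<le> conv d l u F 0 0 0 z"
  shows "p z0 = \<psi>x z0 \<and> \<psi>t z0 - a * \<psi>yy z0 - b * \<psi>xx z0 - c * \<psi>y z0 \<le> F z0"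
proof -
  define L where "L = (\<lambda>z. \<psi>t z - a * \<psi>yy z - b * \<psi>xx z - c * \<psi>y z)"
  \<comment> \<open>Both conclusions are shown up to \<open>2 * e\<close>: one \<open>e\<close> for
    the mean over a small cube, one for moving \<open>\<psi>x\<close> or \<open>L\<close> from
    \<open>z1\<close> to \<open>z0\<close>.\<close>
  have approx: "\<bar>p z0 - \<psi>x z0\<bar> \<le> 2 * e \<and> L z0 \<le> F z0 + 2 * e" if e: "e > 0" for e
  proof -
    have near: "\<exists>r>0. \<forall>z. dist z z0 < r \<longrightarrow> \<bar>q z - q z0\<bar> < e" if "continuous_on (box l u) q" for q :: "pt \<Rightarrow> real"
    proof -
      have "isCont q z0" using that z0 continuous_on_eq_continuous_at open_box by blast
      then show ?thesis using e unfolding continuous_at_eps_delta dist_real_def by blast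
    qed
    note sub = continuous_on_subset[OF _ box_subset_cbox]
    obtain r1 where r1: "r1 > 0" "\<And>z. dist z z0 < r1 \<Longrightarrow> \<bar>p z - p z0\<bar> < e" using near[OF sub[OF p]] by blast
    obtain r2 where r2: "r2 > 0" "\<And>z. dist z z0 < r2 \<Longrightarrow> \<bar>F z - F z0\<bar> < e" using near[OF sub[OF F]] by blast
    obtain r3 where r3: "r3 > 0" "\<And>z. dist z z0 < r3 \<Longrightarrow> \<bar>\<psi>x z - \<psi>x z0\<bar> < e" using near[OF \<psi>x] by blast
    obtain r4 where r4: "r4 > 0" "\<And>z. dist z z0 < r4 \<Longrightarrow> \<bar>L z - L z0\<bar> < e"
      using near[OF L\<psi>] unfolding L_def by blast
    obtain r5 where r5: "r5 > 0" "ball z0 r5 \<subseteq> box l u" using z0 open_box openE by blast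
    \<comment> \<open>The division by 3 leaves room for cubes centred in \<open>cball z0 R\<close>:
      they stay within \<open>2 * R\<close> of \<open>z0\<close>, where all continuity estimates
      hold.\<close>
    define R where "R = min (min (min r1 r2) (min r3 r4)) r5 / 3"
    have R: "R > 0" "3 * R \<le> r1" "3 * R \<le> r2" "3 * R \<le> r3" "3 * R \<le> r4" "3 * R \<le> r5"
      using r1(1) r2(1) r3(1) r4(1) r5(1) by (auto simp: R_def)
    have inbox: "z \<in> box l u" if "dist z z0 < 3 * R" for z
    proof -
      have "z \<in> ball z0 r5" using R(6) that by (simp add: dist_commute)
      then show ?thesis using r5(2) by blast
    qed
    have cb: "cball z0 R \<subseteq> box l u" using inbox R(1) by (auto simp: dist_commute)
    define g where "g = (\<lambda>z. w z - \<psi> z)"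
    have gc: "continuous_on (sphere z0 R) g"
      unfolding g_def using cb sphere_cball[of z0 R] w \<psi> box_subset_cbox[of l u]
      by (intro continuous_intros) (meson continuous_on_subset order_trans)+
    \<comment> \<open>Strict touching and compactness of the sphere give a uniform gap.\<close>
    obtain \<gamma> where \<gamma>: "\<gamma> > 0" "\<And>z. z \<in> sphere z0 R \<Longrightarrow> g z \<le> g z0 - \<gamma>"
    proof (cases "sphere z0 R = {}")
      case True
      then show ?thesis using that[of 1] by auto
    next
      case False
      then obtain m where m: "m \<in> sphere z0 R" "\<And>z. z \<in> sphere z0 R \<Longrightarrow> g z \<le> g m"
        using continuous_attains_sup[OF compact_sphere False gc] by blast
      have "g m < g z0"
        unfolding g_def using m(1) R(1) cb sphere_cball[of z0 R] by (intro strict) auto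
      then show ?thesis using that[of "g z0 - g m"] m(2) by auto
    qed
    obtain \<delta> where \<delta>: "\<delta> > 0"
      "\<And>z z'. z \<in> cbox l u \<Longrightarrow> z' \<in> cbox l u \<Longrightarrow> dist z' z < \<delta> \<Longrightarrow> \<bar>w z' - w z\<bar> < \<gamma> / 3"
      using compact_uniformly_continuous[OF w compact_cbox] \<gamma>(1)
      unfolding uniformly_continuous_on_def dist_real_def by (metis divide_pos_pos zero_less_numeral)
    \<comment> \<open>With \<open>3 * h < \<delta>\<close> mollifying changes \<open>w\<close> by at
      most \<open>\<gamma> / 3\<close> on the ball; with \<open>3 * h < R\<close> the cubes remain
      in the box.\<close>
    define h where "h = min \<delta> R / 4"
    have h: "h > 0" "3 * h < \<delta>" "3 * h < R" using \<delta>(1) R(1) by (auto simp: h_def min_def)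
    obtain d where d: "bump h d" using bump_seq_exists[OF h(1)] h(1) unfolding bump_def by metis
    have sd: "smooth_seq d" using d by (simp add: bump_def)
    define N where "N = integral (cube h 0) (kern d 0 0 0 0)"
    have N: "N > 0" unfolding N_def by (rule kern_mass_pos[OF d])
    have cube_near: "dist \<zeta> z0 < 2 * R" if "\<zeta> \<in> cube h z" "z \<in> cball z0 R" for \<zeta> z
      using dist_cube[OF that(1)] that(2) h(3) dist_triangle[of \<zeta> z0 z] by (simp add: dist_commute)
    have cube_sub: "cube h z \<subseteq> cbox l u" if "z \<in> cball z0 R" for z
      using cube_near[OF _ that] inbox R(1) box_subset_cbox[of l u] by fastforce
    let ?C = "conv d l u w"
    have close: "\<bar>?C 0 0 0 z / N - w z\<bar> \<le> \<gamma> / 3" if "z \<in> cball z0 R" for z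
      unfolding N_def
    proof (rule conv_average[OF d cube_sub[OF that] w])
      fix \<zeta> assume \<zeta>: "\<zeta> \<in> cube h z"
      have "z \<in> cbox l u" using that cb box_subset_cbox by blast
      then have "\<bar>w \<zeta> - w z\<bar> < \<gamma> / 3"
        using \<delta>(2)[of z \<zeta>] \<zeta> cube_sub[OF that] dist_cube[OF \<zeta>] h(2) by auto
      then show "\<bar>w \<zeta> - w z\<bar> \<le> \<gamma> / 3" by simp
    qed
    define G where "G = (\<lambda>z. ?C 0 0 0 z / N - \<psi> z)"
    have "continuous_on (cball z0 R) G"
      unfolding G_def using N
      by (intro continuous_intros continuous_on_conv[OF sd w] continuous_on_subset[OF \<psi> cb]) auto
    then obtain z1 where z1: "z1 \<in> cball z0 R" "\<And>z. z \<in> cball z0 R \<Longrightarrow> G z \<le> G z1"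
      using continuous_attains_sup[OF compact_cball, of z0 R G] R(1) by auto
    \<comment> \<open>Passing from \<open>g\<close> to \<open>G\<close> costs at most
      \<open>\<gamma> / 3\<close> at each of \<open>z0\<close> and \<open>z1\<close>, which is less
      than the gap \<open>\<gamma>\<close>.\<close>
    have "z1 \<notin> sphere z0 R"
    proof
      assume "z1 \<in> sphere z0 R"
      then have "g z1 \<le> g z0 - \<gamma>" by (rule \<gamma>(2))
      moreover have "G z0 \<le> G z1" using z1(2) R(1) by simp
      moreover have "\<bar>?C 0 0 0 z1 / N - w z1\<bar> \<le> \<gamma> / 3" "\<bar>?C 0 0 0 z0 / N - w z0\<bar> \<le> \<gamma> / 3"
        using close z1(1) R(1) by auto
      ultimately show False using \<gamma>(1) unfolding G_def g_def by linarith
    qed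
    then have z1b: "dist z0 z1 < R" using z1(1) by (auto simp: order_less_le)
    \<comment> \<open>Coordinate segments of half-length \<open>\<rho>\<close> around
      \<open>z1\<close> stay in the ball, so one-dimensional maximum conditions apply in each
      variable.\<close>
    define \<rho> where "\<rho> = R - dist z0 z1"
    have \<rho>: "\<rho> > 0" using z1b by (simp add: \<rho>_def)
    obtain x y t where z1e: "z1 = (x, y, t)" by (cases z1)
    have near1: "z \<in> cball z0 R" if "dist z z1 < \<rho>" for z
      using dist_triangle[of z0 z z1] that by (simp add: \<rho>_def dist_commute)
    have bx: "(s, y, t) \<in> cball z0 R" if "\<bar>s - x\<bar> < \<rho>" for s
      using near1[of "(s, y, t)"] that by (simp add: z1e dist_Pair_Pair dist_real_def)
    have by': "(x, s, t) \<in> cball z0 R" if "\<bar>s - y\<bar> < \<rho>" for s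
      using near1[of "(x, s, t)"] that by (simp add: z1e dist_Pair_Pair dist_real_def)
    have bt: "(x, y, s) \<in> cball z0 R" if "\<bar>s - t\<bar> < \<rho>" for s
      using near1[of "(x, y, s)"] that by (simp add: z1e dist_Pair_Pair dist_real_def)
    note cd = conv_has_derivative[OF sd w]
    \<comment> \<open>The first derivative of the mollification carries a minus sign, the second
      none, since each derivative in \<open>z\<close> reverses the sign once.\<close>
    have X: "- ?C 1 0 0 z1 / N - \<psi>x z1 = 0" "?C 2 0 0 z1 / N - \<psi>xx z1 \<le> 0"
    proof -
      have 1: "((\<lambda>s. G (s, y, t)) has_real_derivative - ?C 1 0 0 (s, y, t) / N - \<psi>x (s, y, t)) (at s)"
        if "\<bar>s - x\<bar> < \<rho>" for s
        unfolding G_def using deriv[of s y t] bx[OF that] cb cd(1)[of 0 0 0 y t s]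
        by (intro DERIV_diff DERIV_cdivide) auto
      have "((\<lambda>s. - ?C 1 0 0 (s, y, t) / N - \<psi>x (s, y, t)) has_real_derivative
          - (- ?C 2 0 0 z1) / N - \<psi>xx z1) (at x)"
        using deriv[of x y t] z1(1) cb cd(1)[of 1 0 0 y t x] unfolding z1e
        by (intro DERIV_diff DERIV_cdivide DERIV_minus) (auto simp: numeral_2_eq_2)
      from local_max_derivs[OF \<rho> 1 this] z1(2)[OF bx]
      show "- ?C 1 0 0 z1 / N - \<psi>x z1 = 0" "?C 2 0 0 z1 / N - \<psi>xx z1 \<le> 0"
        by (auto simp: z1e)
    qed
    have Y: "- ?C 0 1 0 z1 / N - \<psi>y z1 = 0" "?C 0 2 0 z1 / N - \<psi>yy z1 \<le> 0"
    proof -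
      have 1: "((\<lambda>s. G (x, s, t)) has_real_derivative - ?C 0 1 0 (x, s, t) / N - \<psi>y (x, s, t)) (at s)"
        if "\<bar>s - y\<bar> < \<rho>" for s
        unfolding G_def using deriv[of x s t] by'[OF that] cb cd(2)[of 0 0 0 x t s]
        by (intro DERIV_diff DERIV_cdivide) auto
      have "((\<lambda>s. - ?C 0 1 0 (x, s, t) / N - \<psi>y (x, s, t)) has_real_derivative
          - (- ?C 0 2 0 z1) / N - \<psi>yy z1) (at y)"
        using deriv[of x y t] z1(1) cb cd(2)[of 0 1 0 x t y] unfolding z1e
        by (intro DERIV_diff DERIV_cdivide DERIV_minus) (auto simp: numeral_2_eq_2)
      from local_max_derivs[OF \<rho> 1 this] z1(2)[OF by']
      show "- ?C 0 1 0 z1 / N - \<psi>y z1 = 0" "?C 0 2 0 z1 / N - \<psi>yy z1 \<le> 0"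
        by (auto simp: z1e)
    qed
    have T: "- ?C 0 0 1 z1 / N - \<psi>t z1 = 0"
    proof (rule DERIV_local_max[OF _ \<rho>])
      show "((\<lambda>s. G (x, y, s)) has_real_derivative - ?C 0 0 1 z1 / N - \<psi>t z1) (at t)"
        unfolding G_def z1e using deriv[of x y t] z1(1) cb cd(3)[of 0 0 0 x y t] z1e
        by (intro DERIV_diff DERIV_cdivide) auto
      show "\<forall>s. \<bar>t - s\<bar> < \<rho> \<longrightarrow> G (x, y, s) \<le> G (x, y, t)"
        using z1(2)[OF bt] by (auto simp: z1e abs_minus_commute)
    qed
    have W: "conv d l u p 0 0 0 z1 = - ?C 1 0 0 z1"
      "- ?C 0 0 1 z1 - a * ?C 0 2 0 z1 - b * ?C 2 0 0 z1 + c * ?C 0 1 0 z1 \<le> conv d l u F 0 0 0 z1"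
      using weak[OF d cube_sub[OF z1(1)]] by auto
    have d2: "dist \<zeta> z0 < 3 * R" if "\<zeta> \<in> cube h z1" for \<zeta>
      using cube_near[OF that z1(1)] R(1) by simp
    have P: "\<bar>conv d l u p 0 0 0 z1 / N - p z0\<bar> \<le> e"
      unfolding N_def using d2 R(2)
      by (intro conv_average[OF d cube_sub[OF z1(1)] p]) (meson less_imp_le less_le_trans r1(2))
    have Fe: "\<bar>conv d l u F 0 0 0 z1 / N - F z0\<bar> \<le> e"
      unfolding N_def using d2 R(3)
      by (intro conv_average[OF d cube_sub[OF z1(1)] F]) (meson less_imp_le less_le_trans r2(2))
    have d1: "dist z1 z0 < 3 * R" using z1b R(1) by (simp add: dist_commute)
    have "conv d l u p 0 0 0 z1 / N = \<psi>x z1" using X(1) W(1) by simp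
    then have 1: "\<bar>p z0 - \<psi>x z0\<bar> \<le> 2 * e" using P r3(2)[of z1] d1 R(4) by linarith
    \<comment> \<open>First-order terms agree at the maximum; the second-order ones compare in the
      right direction because \<open>a\<close> and \<open>b\<close> are nonnegative.\<close>
    have "L z1 \<le> - ?C 0 0 1 z1 / N - a * (?C 0 2 0 z1 / N) - b * (?C 2 0 0 z1 / N) + c * (?C 0 1 0 z1 / N)"
    proof -
      have "\<psi>t z1 = - ?C 0 0 1 z1 / N" "\<psi>y z1 = - (?C 0 1 0 z1 / N)" using T Y(1) by auto
      moreover have "a * (?C 0 2 0 z1 / N) \<le> a * \<psi>yy z1" "b * (?C 2 0 0 z1 / N) \<le> b * \<psi>xx z1"
        using X(2) Y(2) ab by (simp_all only: diff_le_0_iff_le mult_left_mono)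
      ultimately show ?thesis unfolding L_def by simp
    qed
    also have "\<dots> = (- ?C 0 0 1 z1 - a * ?C 0 2 0 z1 - b * ?C 2 0 0 z1 + c * ?C 0 1 0 z1) / N"
      by (simp add: diff_divide_distrib add_divide_distrib)
    also have "\<dots> \<le> conv d l u F 0 0 0 z1 / N" using W(2) N by (simp add: divide_right_mono)
    finally have "L z0 \<le> F z0 + 2 * e" using Fe r4(2)[of z1] d1 R(5) by linarith
    with 1 show ?thesis by blast
  qed
  have "\<bar>p z0 - \<psi>x z0\<bar> \<le> 0"
  proof (rule field_le_epsilon)
    fix e :: real assume "e > 0"
    then show "\<bar>p z0 - \<psi>x z0\<bar> \<le> 0 + e" using approx[of "e / 2"] by simp
  qed
  moreover have "L z0 \<le> F z0"
  proof (rule field_le_epsilon)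
    fix e :: real assume "e > 0"
    then show "L z0 \<le> F z0 + e" using approx[of "e / 2"] by simp
  qed
  ultimately show ?thesis by (simp add: L_def)
qed

section \<open>Testing the weak differential inequality with the mollifier\<close>

lemma dird_kern:
  assumes "smooth_seq d"
  shows "dird ex (kern d i j k z) = kern d (Suc i) j k z"
    "dird ey (kern d i j k z) = kern d i (Suc j) k z"
    "dird et (kern d i j k z) = kern d i j (Suc k) z"
proof -
  obtain x y t where "z = (x, y, t)" by (cases z)
  then show "dird ex (kern d i j k z) = kern d (Suc i) j k z"
    "dird ey (kern d i j k z) = kern d i (Suc j) k z"
    "dird et (kern d i j k z) = kern d i j (Suc k) z"
    using dird_tens[OF smooth_seq_shift[OF assms, of x] smooth_seq_shift[OF assms, of y]
        smooth_seq_shift[OF assms, of t]]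
    by (simp_all add: kern_def)
qed

lemma test_fun_kern:
  assumes "bump h d" "cube h z \<subseteq> interior S"
  shows "test_fun S (kern d i j k z)"
proof -
  obtain x y t where z: "z = (x, y, t)" by (cases z)
  have "smooth_seq d" using assms by (simp add: bump_def)
  then show ?thesis
    using test_fun_tens[OF smooth_seq_shift[of d x] smooth_seq_shift[of d y] smooth_seq_shift[of d t]
        assms(2)[unfolded cube_def]] kern_outside[OF assms(1), of _ z i j k]
    by (simp add: kern_def z cube_def)
qed

text \<open>Integrability is included because integrals are subtracted later, and the Bochner
  integral of a non-integrable function is 0 by default. The premise on \<open>ds\<close> expresses
  the derivatives of the kernel by its indices.\<close>

lemma has_weak_deriv_kern:
  assumes v: "has_weak_deriv S ds v g" and d: "bump h d" and z: "cube h z \<subseteq> interior S"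
    and ds: "foldr dird ds (kern d 0 0 0 z) = kern d i j k z"
  shows "integrable (lebesgue_on (interior S)) (\<lambda>\<zeta>. v \<zeta> * kern d i j k z \<zeta>)"
    "integrable (lebesgue_on (interior S)) (\<lambda>\<zeta>. g \<zeta> * kern d 0 0 0 z \<zeta>)"
    "(\<integral>\<zeta>. v \<zeta> * kern d i j k z \<zeta> \<partial>lebesgue_on (interior S))
      = (-1) ^ length ds * (\<integral>\<zeta>. g \<zeta> * kern d 0 0 0 z \<zeta> \<partial>lebesgue_on (interior S))"
proof -
  have sd: "smooth_seq d" using d by (simp add: bump_def)
  have c: "compact (cube h z)" by (simp add: cube_def)
  show "integrable (lebesgue_on (interior S)) (\<lambda>\<zeta>. v \<zeta> * kern d i j k z \<zeta>)"
    "integrable (lebesgue_on (interior S)) (\<lambda>\<zeta>. g \<zeta> * kern d 0 0 0 z \<zeta>)"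
    using v unfolding has_weak_deriv_def
    by (auto intro!: Lp_loc_mult_integrable[OF open_interior _ continuous_on_kern[OF sd] c z]
        kern_outside[OF d])
  show "(\<integral>\<zeta>. v \<zeta> * kern d i j k z \<zeta> \<partial>lebesgue_on (interior S))
      = (-1) ^ length ds * (\<integral>\<zeta>. g \<zeta> * kern d 0 0 0 z \<zeta> \<partial>lebesgue_on (interior S))"
    using v test_fun_kern[OF d z, of 0 0 0] unfolding has_weak_deriv_def ds[symmetric] by blast
qed

text \<open>Supplies the premise \<open>weak\<close> of \<open>strict_touching\<close>. Testing with
  a nonnegative kernel preserves the a.e. inequality, and the constant coefficients pass through the
  integral.\<close>

lemma weak_differential_inequality:
  fixes v1 v2 p F :: "pt \<Rightarrow> real" and g1 g2 :: "pt list \<Rightarrow> pt \<Rightarrow> real"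
  assumes lu: "cbox l u \<subseteq> interior S"
    and g1: "\<And>ds. ds \<in> {[ex], [ey], [ex, ex], [ey, ey], [et]} \<Longrightarrow> has_weak_deriv S ds v1 (g1 ds)"
    and g2: "\<And>ds. ds \<in> {[ex], [ey], [ex, ex], [ey, ey], [et]} \<Longrightarrow> has_weak_deriv S ds v2 (g2 ds)"
    and w: "continuous_on (cbox l u) (\<lambda>z. v2 z - v1 z)"
    and p: "continuous_on (cbox l u) p" and F: "continuous_on (cbox l u) F"
    and pae: "AE z in lebesgue_on (interior S). z \<in> cbox l u \<longrightarrow> g2 [ex] z - g1 [ex] z = p z"
    and Fae: "AE z in lebesgue_on (interior S). z \<in> cbox l u \<longrightarrow>
      g2 [et] z - g1 [et] z - a * (g2 [ey, ey] z - g1 [ey, ey] z) - b * (g2 [ex, ex] z - g1 [ex, ex] z)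
        - c * (g2 [ey] z - g1 [ey] z) \<le> F z"
    and d: "bump h d" and z: "cube h z \<subseteq> cbox l u"
  defines "C \<equiv> conv d l u (\<lambda>z. v2 z - v1 z)"
  shows "conv d l u p 0 0 0 z = - C 1 0 0 z"
    "- C 0 0 1 z - a * C 0 2 0 z - b * C 2 0 0 z + c * C 0 1 0 z \<le> conv d l u F 0 0 0 z"
proof -
  let ?M = "lebesgue_on (interior S)"
  let ?k = "kern d 0 0 0 z"
  have sd: "smooth_seq d" using d by (simp add: bump_def)
  have zS: "cube h z \<subseteq> interior S" using z lu by blast
  have k0: "kern d i j k z \<zeta> = 0" if "\<zeta> \<notin> cbox l u" for i j k \<zeta>
    using kern_outside[OF d] z that by blast
  have conv: "conv d l u q i j k z = (\<integral>\<zeta>. q \<zeta> * kern d i j k z \<zeta> \<partial>?M)"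
    "integrable ?M (\<lambda>\<zeta>. q \<zeta> * kern d i j k z \<zeta>)"
    if "continuous_on (cbox l u) q" for q i j k
    unfolding conv_def
    using lebesgue_integral_eq_cbox_integral[OF open_interior lu, of "\<lambda>\<zeta>. q \<zeta> * kern d i j k z \<zeta>"] k0
      continuous_on_mult[OF that continuous_on_kern[OF sd]] by auto
  define D where "D = (\<lambda>ds \<zeta>. g2 ds \<zeta> - g1 ds \<zeta>)"
  have Ci: "C i j k z = (-1) ^ length ds * (\<integral>\<zeta>. D ds \<zeta> * ?k \<zeta> \<partial>?M)"
    and Di: "integrable ?M (\<lambda>\<zeta>. D ds \<zeta> * ?k \<zeta>)"
    if ds: "ds \<in> {[ex], [ey], [ex, ex], [ey, ey], [et]}" "foldr dird ds ?k = kern d i j k z" for ds i j k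
  proof -
    note 1 = has_weak_deriv_kern[OF g1[OF ds(1)] d zS ds(2)]
    note 2 = has_weak_deriv_kern[OF g2[OF ds(1)] d zS ds(2)]
    show "integrable ?M (\<lambda>\<zeta>. D ds \<zeta> * ?k \<zeta>)"
      using Bochner_Integration.integrable_diff[OF 2(2) 1(2)] by (simp add: D_def left_diff_distrib)
    show "C i j k z = (-1) ^ length ds * (\<integral>\<zeta>. D ds \<zeta> * ?k \<zeta> \<partial>?M)"
      unfolding C_def conv(1)[OF w] D_def left_diff_distrib
        Bochner_Integration.integral_diff[OF 2(1) 1(1)] Bochner_Integration.integral_diff[OF 2(2) 1(2)]
        1(3) 2(3) by (simp add: algebra_simps)
  qed
  \<comment> \<open>Integration by parts gives a minus sign for a single derivative and none for a
    double one.\<close>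
  have x: "C 1 0 0 z = - (\<integral>\<zeta>. D [ex] \<zeta> * ?k \<zeta> \<partial>?M)" "integrable ?M (\<lambda>\<zeta>. D [ex] \<zeta> * ?k \<zeta>)"
    using Ci[of "[ex]" 1 0 0] Di[of "[ex]" 1 0 0] by (simp_all add: dird_kern[OF sd])
  have y: "C 0 1 0 z = - (\<integral>\<zeta>. D [ey] \<zeta> * ?k \<zeta> \<partial>?M)" "integrable ?M (\<lambda>\<zeta>. D [ey] \<zeta> * ?k \<zeta>)"
    using Ci[of "[ey]" 0 1 0] Di[of "[ey]" 0 1 0] by (simp_all add: dird_kern[OF sd])
  have t: "C 0 0 1 z = - (\<integral>\<zeta>. D [et] \<zeta> * ?k \<zeta> \<partial>?M)" "integrable ?M (\<lambda>\<zeta>. D [et] \<zeta> * ?k \<zeta>)"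
    using Ci[of "[et]" 0 0 1] Di[of "[et]" 0 0 1] by (simp_all add: dird_kern[OF sd])
  have xx: "C 2 0 0 z = (\<integral>\<zeta>. D [ex, ex] \<zeta> * ?k \<zeta> \<partial>?M)" "integrable ?M (\<lambda>\<zeta>. D [ex, ex] \<zeta> * ?k \<zeta>)"
    using Ci[of "[ex, ex]" 2 0 0] Di[of "[ex, ex]" 2 0 0] by (simp_all add: dird_kern[OF sd] numeral_2_eq_2)
  have yy: "C 0 2 0 z = (\<integral>\<zeta>. D [ey, ey] \<zeta> * ?k \<zeta> \<partial>?M)" "integrable ?M (\<lambda>\<zeta>. D [ey, ey] \<zeta> * ?k \<zeta>)"
    using Ci[of "[ey, ey]" 0 2 0] Di[of "[ey, ey]" 0 2 0] by (simp_all add: dird_kern[OF sd] numeral_2_eq_2)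
  have "conv d l u p 0 0 0 z = (\<integral>\<zeta>. D [ex] \<zeta> * ?k \<zeta> \<partial>?M)"
    unfolding conv(1)[OF p]
  proof (rule integral_cong_AE)
    show "AE \<zeta> in ?M. p \<zeta> * ?k \<zeta> = D [ex] \<zeta> * ?k \<zeta>"
      using pae by eventually_elim (use k0 in \<open>auto simp: D_def\<close>)
  qed (use conv(2)[OF p] x(2) in auto)
  then show "conv d l u p 0 0 0 z = - C 1 0 0 z" using x(1) by simp
  have "- C 0 0 1 z - a * C 0 2 0 z - b * C 2 0 0 z + c * C 0 1 0 z
      = (\<integral>\<zeta>. D [et] \<zeta> * ?k \<zeta> - a * (D [ey, ey] \<zeta> * ?k \<zeta>) - b * (D [ex, ex] \<zeta> * ?k \<zeta>)
          - c * (D [ey] \<zeta> * ?k \<zeta>) \<partial>?M)"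
    using x y t xx yy by simp
  also have "\<dots> \<le> (\<integral>\<zeta>. F \<zeta> * ?k \<zeta> \<partial>?M)"
  proof (rule integral_mono_AE)
    show "AE \<zeta> in ?M. D [et] \<zeta> * ?k \<zeta> - a * (D [ey, ey] \<zeta> * ?k \<zeta>) - b * (D [ex, ex] \<zeta> * ?k \<zeta>)
          - c * (D [ey] \<zeta> * ?k \<zeta>) \<le> F \<zeta> * ?k \<zeta>"
      using Fae
    proof eventually_elim
      fix \<zeta>
      assume A: "\<zeta> \<in> cbox l u \<longrightarrow>
        g2 [et] \<zeta> - g1 [et] \<zeta> - a * (g2 [ey, ey] \<zeta> - g1 [ey, ey] \<zeta>) - b * (g2 [ex, ex] \<zeta> - g1 [ex, ex] \<zeta>)
          - c * (g2 [ey] \<zeta> - g1 [ey] \<zeta>) \<le> F \<zeta>"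
      have "(D [et] \<zeta> - a * D [ey, ey] \<zeta> - b * D [ex, ex] \<zeta> - c * D [ey] \<zeta>) * ?k \<zeta> \<le> F \<zeta> * ?k \<zeta>"
      proof (cases "\<zeta> \<in> cbox l u")
        case True
        then show ?thesis using A unfolding D_def by (intro mult_right_mono kern_nonneg[OF d]) auto
      qed (use k0 in simp)
      then show "D [et] \<zeta> * ?k \<zeta> - a * (D [ey, ey] \<zeta> * ?k \<zeta>) - b * (D [ex, ex] \<zeta> * ?k \<zeta>)
          - c * (D [ey] \<zeta> * ?k \<zeta>) \<le> F \<zeta> * ?k \<zeta>"
        by (simp add: algebra_simps)
    qed
  qed (use conv(2)[OF F] x(2) y(2) t(2) xx(2) yy(2) in auto)
  finally show "- C 0 0 1 z - a * C 0 2 0 z - b * C 2 0 0 z + c * C 0 1 0 z \<le> conv d l u F 0 0 0 z"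
    by (simp add: conv(1)[OF F])
qed

section \<open>The penalized maximum\<close>

text \<open>The domain without its top \<open>t = T\<close>, hence open; the top is recovered by
  continuity at the end.\<close>

definition slab :: "real \<Rightarrow> pt set" where
  "slab T = {(x, y, t). 0 < t \<and> t < T}"

lemma mem_slab [simp]: "(x, y, t) \<in> slab T \<longleftrightarrow> 0 < t \<and> t < T"
  by (simp add: slab_def)

lemma open_slab: "open (slab T)"
proof -
  have "slab T = {z. 0 < snd (snd z)} \<inter> {z. snd (snd z) < T}" by (auto simp: slab_def)
  then show ?thesis by (auto intro!: open_Int open_Collect_less continuous_intros)
qed

lemma slab_subset_Q: "slab T \<subseteq> Q T"
  by (auto simp: slab_def Q_def)

lemma slab_subset_interior_Q: "slab T \<subseteq> interior (Q T)"
  by (rule interior_maximal[OF slab_subset_Q open_slab])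

lemma Q_sets_lebesgue: "Q T \<in> sets lebesgue"
proof -
  have "open {z :: pt. 0 < snd (snd z)}" "closed {z :: pt. snd (snd z) \<le> T}"
    by (intro open_Collect_less closed_Collect_le continuous_intros)+
  moreover have "Q T = {z. 0 < snd (snd z)} \<inter> {z. snd (snd z) \<le> T}" by (auto simp: Q_def)
  ultimately show ?thesis by (simp add: borel_open borel_closed sets.Int)
qed

lemma AE_interior_Q:
  assumes "AE z in lebesgue_on (Q T). P z"
  shows "AE z in lebesgue_on (interior (Q T)). P z"
proof -
  have "AE z in lebesgue. z \<in> Q T \<longrightarrow> P z"
    using assms Q_sets_lebesgue by (simp add: AE_restrict_space_iff)
  then have "AE z in lebesgue. z \<in> interior (Q T) \<longrightarrow> P z"
    by eventually_elim (use interior_subset in blast)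
  then show ?thesis by (simp add: AE_restrict_space_iff borel_open)
qed

text \<open>By continuity the set where the a.e. bound fails is open in the slab; being null, it is
  empty.\<close>

lemma Linfty_bounded_slab:
  assumes v: "v \<in> Linfty (Q T)" and c: "continuous_on (Q T) v"
  obtains C where "C > 0" "\<And>z. z \<in> slab T \<Longrightarrow> \<bar>v z\<bar> \<le> C"
proof -
  obtain C where C: "AE z in lebesgue_on (Q T). \<bar>v z\<bar> \<le> C" using v by (auto simp: Linfty_def)
  define V where "V = slab T \<inter> (\<lambda>z. \<bar>v z\<bar>) -` {C<..}"
  have "continuous_on (slab T) (\<lambda>z. \<bar>v z\<bar>)"
    by (intro continuous_intros continuous_on_subset[OF c slab_subset_Q])
  then have V: "open V"
    unfolding V_def by (intro continuous_open_preimage open_slab) auto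
  have "AE z in lebesgue. z \<in> Q T \<longrightarrow> \<bar>v z\<bar> \<le> C"
    using C Q_sets_lebesgue by (simp add: AE_restrict_space_iff)
  then have "AE z in lebesgue. z \<notin> V"
    by eventually_elim (use slab_subset_Q in \<open>auto simp: V_def\<close>)
  moreover have "V \<in> sets lebesgue" using V by (simp add: borel_open)
  ultimately have "V \<in> null_sets lebesgue"
    by (simp add: AE_iff_null_sets)
  then have "V = {}" using open_not_negligible[OF V] negligible_iff_null_sets by blast
  then have "\<bar>v z\<bar> \<le> max C 1" if "z \<in> slab T" for z
    using that by (force simp: V_def not_less)
  then show thesis using that[of "max C 1"] by simp
qed

section \<open>The initial condition in pointwise form\<close>

lemma ncdf_bounds: "0 \<le> ncdf x" "ncdf x \<le> 1"
proof -
  have eq: "ncdf x = (\<integral>u. indicator {..x} u *\<^sub>R std_normal_density u \<partial>lborel)"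
    unfolding ncdf_def set_lebesgue_integral_def std_normal_density_def by simp
  show "0 \<le> ncdf x" unfolding eq by (intro integral_nonneg_AE) auto
  have "ncdf x \<le> (\<integral>u. std_normal_density u \<partial>lborel)"
    unfolding eq
    by (intro integral_mono integrable_mult_indicator integrable_normal_density)
      (auto simp: indicator_def)
  then show "ncdf x \<le> 1" by simp
qed

text \<open>\<open>SUP\<close> dominates its members only for a family that is bounded above. The
  bounds on \<open>v\<close> and \<open>ncdf\<close> ensure this as long as
  \<open>t < T\<close>.\<close>

lemma initial_cond_small:
  assumes i: "initial_cond \<nu> v" and b: "\<And>z. z \<in> slab T \<Longrightarrow> \<bar>v z\<bar> \<le> C" and "T > 0" "A > 0" "\<gamma> > 0"
  obtains \<tau> where "\<tau> > 0" "\<And>x y t. 0 < t \<Longrightarrow> t < \<tau> \<Longrightarrow> t < T \<Longrightarrow> \<bar>y\<bar> \<le> A \<Longrightarrow>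
      \<bar>v (x, y, t) - ncdf (x / (\<nu> * sqrt t))\<bar> < \<gamma>"
proof -
  define f where "f = (\<lambda>t (x, y). \<bar>v (x, y, t) - ncdf (x / (\<nu> * sqrt t))\<bar>)"
  define B where "B = {(x :: real, y). \<bar>y\<bar> \<le> A}"
  have "((\<lambda>t. SUP z\<in>B. f t z) \<longlongrightarrow> 0) (at_right 0)"
    using i \<open>A > 0\<close> unfolding initial_cond_def f_def B_def by (simp add: split_beta)
  then have "\<forall>\<^sub>F t in at_right 0. (SUP z\<in>B. f t z) < \<gamma>"
    using \<open>\<gamma> > 0\<close> by (rule order_tendstoD)
  then obtain \<tau> where \<tau>: "\<tau> > 0" "\<And>t. 0 < t \<Longrightarrow> t < \<tau> \<Longrightarrow> (SUP z\<in>B. f t z) < \<gamma>"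
    unfolding eventually_at_right_field by auto
  have "f t (x, y) < \<gamma>" if t: "0 < t" "t < \<tau>" "t < T" "\<bar>y\<bar> \<le> A" for x y t
  proof -
    have "f t z \<le> C + 1" for z
      using b[of "(fst z, snd z, t)"] ncdf_bounds[of "fst z / (\<nu> * sqrt t)"] t
      by (auto simp: f_def split_beta)
    then have "bdd_above (f t ` B)" by (auto intro!: bdd_aboveI)
    then have "f t (x, y) \<le> (SUP z\<in>B. f t z)" using t by (intro cSUP_upper) (auto simp: B_def)
    then show ?thesis using \<tau>(2)[of t] t by simp
  qed
  then show thesis using that[OF \<tau>(1)] by (simp add: f_def)
qed

text \<open>The \<open>x\<close>-derivative of the barrier, multiplied by \<open>exp y\<close>, is dominated by the barrier itself.\<close>

definition barrier :: "real \<Rightarrow> real \<Rightarrow> real" where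
  "barrier x y = x\<^sup>2 + exp (2 * y) + exp (- 2 * y)"

text \<open>The bounds on \<open>x\<close> and \<open>y\<close> confine the penalized maximum to a
  compact set; the last one absorbs the drift. They follow from \<open>1 + s \<le> exp s\<close> and
  from squares being nonnegative.\<close>

lemma barrier_ge: "2 \<le> barrier x y" "2 * \<bar>x\<bar> \<le> barrier x y" "2 * \<bar>y\<bar> \<le> barrier x y"
    "2 * (\<bar>x\<bar> * exp y) \<le> barrier x y"
proof -
  have e: "2 \<le> exp (2 * y) + exp (- 2 * y)"
    using exp_ge_add_one_self[of "2 * y"] exp_ge_add_one_self[of "- 2 * y"] by linarith
  then show "2 \<le> barrier x y" using zero_le_power2[of x] unfolding barrier_def by linarith
  have "2 * \<bar>x\<bar> \<le> x\<^sup>2 + 1" using zero_le_power2[of "\<bar>x\<bar> - 1"] by (simp add: power2_diff)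
  then show "2 * \<bar>x\<bar> \<le> barrier x y" using e unfolding barrier_def by linarith
  have "2 * y \<le> exp (2 * y)" "- 2 * y \<le> exp (- 2 * y)"
    using exp_ge_add_one_self[of "2 * y"] exp_ge_add_one_self[of "- 2 * y"] by linarith+
  moreover have "0 < exp (2 * y)" "0 < exp (- 2 * y)" "0 \<le> x\<^sup>2" by simp_all
  ultimately show "2 * \<bar>y\<bar> \<le> barrier x y" unfolding barrier_def by linarith
  have "2 * (\<bar>x\<bar> * exp y) \<le> x\<^sup>2 + exp (2 * y)"
    using zero_le_power2[of "\<bar>x\<bar> - exp y"] by (simp add: power2_diff exp_double)
  then show "2 * (\<bar>x\<bar> * exp y) \<le> barrier x y"
    using exp_gt_zero[of "- 2 * y"] unfolding barrier_def by linarith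
qed

text \<open>The left-hand side is \<open>a\<close>, \<open>b\<close>, \<open>c\<close> times the
  \<open>yy\<close>, \<open>xx\<close> and \<open>y\<close> derivatives of the barrier, plus
  \<open>D * exp y\<close> times the modulus of its \<open>x\<close> derivative. The constant on the
  right enters the choice of \<open>\<kappa>\<close>.\<close>

lemma barrier_supersolution:
  assumes "0 \<le> a" "0 \<le> b" "0 \<le> c" "0 \<le> D"
  shows "a * (4 * (exp (2 * y) + exp (- 2 * y))) + b * 2 + c * (2 * (exp (2 * y) - exp (- 2 * y)))
      + D * (exp y * (2 * \<bar>x\<bar>)) \<le> (4 * a + b + 2 * c + D) * barrier x y"
proof -
  have "exp (2 * y) + exp (- 2 * y) \<le> barrier x y" "exp (2 * y) - exp (- 2 * y) \<le> barrier x y"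
    using zero_le_power2[of x] exp_gt_zero[of "- 2 * y"] unfolding barrier_def by linarith+
  moreover have "exp y * (2 * \<bar>x\<bar>) \<le> barrier x y"
    using barrier_ge(4)[of x y] by (simp add: mult_ac)
  ultimately have "a * (4 * (exp (2 * y) + exp (- 2 * y))) \<le> a * (4 * barrier x y)" "b * 2 \<le> b * barrier x y"
    "c * (2 * (exp (2 * y) - exp (- 2 * y))) \<le> c * (2 * barrier x y)"
    "D * (exp y * (2 * \<bar>x\<bar>)) \<le> D * barrier x y"
    using barrier_ge(1)[of x y] assms by (simp_all add: mult_left_mono)
  then show ?thesis by (simp add: algebra_simps)
qed

text \<open>The barrier prevents a maximizing sequence from escaping in \<open>x\<close> and
  \<open>y\<close>, the term \<open>\<eta> / (T - t)\<close> from reaching the top, and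
  \<open>init\<close> from reaching \<open>t = 0\<close>.\<close>

lemma penalized_max_exists:
  fixes w :: "pt \<Rightarrow> real"
  assumes w: "continuous_on (slab T) w" and C: "\<And>z. z \<in> slab T \<Longrightarrow> w z \<le> C" "C > 0"
    and init: "\<And>A \<gamma>. A > 0 \<Longrightarrow> \<gamma> > 0 \<Longrightarrow>
      \<exists>\<tau>>0. \<forall>x y t. 0 < t \<longrightarrow> t < \<tau> \<longrightarrow> t < T \<longrightarrow> \<bar>y\<bar> \<le> A \<longrightarrow> w (x, y, t) < \<gamma>"
    and pos: "z1 \<in> slab T" "w z1 > 0" and \<kappa>: "\<kappa> \<ge> 0"
  obtains \<epsilon> \<eta> M z0 where "\<epsilon> > 0" "\<eta> > 0" "M > 0" "z0 \<in> slab T"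
    "\<forall>x y t. (x, y, t) \<in> slab T \<longrightarrow> w (x, y, t) \<le> exp (\<kappa> * t) * (M + \<epsilon> * barrier x y + \<eta> / (T - t))"
    "\<forall>x y t. z0 = (x, y, t) \<longrightarrow> w z0 = exp (\<kappa> * t) * (M + \<epsilon> * barrier x y + \<eta> / (T - t))"
proof -
  obtain x1 y1 t1 where z1: "z1 = (x1, y1, t1)" by (cases z1)
  have t1: "0 < t1" "t1 < T" using pos z1 by auto
  \<comment> \<open>Each of the two penalties costs \<open>\<delta> / 4\<close> at
    \<open>z1\<close>, so that \<open>G z1 = \<delta> / 2\<close>.\<close>
  define \<delta> where "\<delta> = exp (- \<kappa> * t1) * w z1"
  have \<delta>: "\<delta> > 0" using pos by (simp add: \<delta>_def)
  define \<epsilon> where "\<epsilon> = \<delta> / (4 * barrier x1 y1)"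
  define \<eta> where "\<eta> = \<delta> * (T - t1) / 4"
  have bp: "barrier x y > 0" for x y using barrier_ge(1)[of x y] by linarith
  have \<epsilon>: "\<epsilon> > 0" "\<epsilon> * barrier x1 y1 = \<delta> / 4" using \<delta> bp[of x1 y1] by (auto simp: \<epsilon>_def)
  have \<eta>: "\<eta> > 0" "\<eta> / (T - t1) = \<delta> / 4" using \<delta> t1 by (simp_all add: \<eta>_def divide_eq_eq)
  define G where "G = (\<lambda>(x, y, t). exp (- \<kappa> * t) * w (x, y, t) - \<epsilon> * barrier x y - \<eta> / (T - t))"
  have G1: "G z1 = \<delta> / 2" using \<epsilon>(2) \<eta>(2) by (simp add: G_def z1 \<delta>_def)
  define A where "A = C / \<epsilon>"
  have A: "A > 0" using C(2) \<epsilon>(1) by (simp add: A_def)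
  obtain \<tau> where \<tau>: "\<tau> > 0"
    "\<And>x y t. 0 < t \<Longrightarrow> t < \<tau> \<Longrightarrow> t < T \<Longrightarrow> \<bar>y\<bar> \<le> A \<Longrightarrow> w (x, y, t) < \<delta> / 2"
    using init[OF A, of "\<delta> / 2"] \<delta> by auto
  define K where "K = {- A..A} \<times> {- A..A} \<times> {\<tau>..T - \<eta> / C}"
  \<comment> \<open>Here \<open>w\<close> is positive, so
    \<open>exp (- \<kappa> * t) * w \<le> C\<close> and each penalty is at most \<open>C\<close>;
    this bounds \<open>x\<close>, \<open>y\<close> and \<open>t\<close> from above. Since also
    \<open>w \<ge> \<delta> / 2\<close>, times below \<open>\<tau>\<close> are excluded. A maximum
    over \<open>K\<close> is thus a maximum over the slab.\<close>
  have inK: "(x, y, t) \<in> K" if z: "(x, y, t) \<in> slab T" and g: "G (x, y, t) \<ge> \<delta> / 2" for x y t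
  proof -
    have t: "0 < t" "t < T" using z by auto
    have e: "exp (- \<kappa> * t) \<le> 1" "exp (- \<kappa> * t) > 0" using \<kappa> t by auto
    have eta: "\<eta> / (T - t) > 0" using \<eta>(1) t by simp
    have eb: "\<epsilon> * barrier x y > 0" using \<epsilon>(1) bp by simp
    have sum: "exp (- \<kappa> * t) * w (x, y, t) \<ge> \<delta> / 2 + \<epsilon> * barrier x y + \<eta> / (T - t)"
      using g by (simp add: G_def)
    have wpos: "w (x, y, t) > 0"
    proof (rule ccontr)
      assume "\<not> w (x, y, t) > 0"
      then have "exp (- \<kappa> * t) * w (x, y, t) \<le> 0" using e(2) by (simp add: mult_nonneg_nonpos)
      then show False using sum eb eta \<delta> by linarith
    qed
    have le: "exp (- \<kappa> * t) * w (x, y, t) \<le> w (x, y, t)"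
      using mult_right_mono[OF e(1), of "w (x, y, t)"] wpos by simp
    have wC: "w (x, y, t) \<le> C" by (rule C(1)[OF z])
    have "\<epsilon> * barrier x y \<le> C" "\<eta> / (T - t) \<le> C" "w (x, y, t) \<ge> \<delta> / 2"
      using sum le wC eb eta \<delta> by linarith+
    then have "barrier x y \<le> A" "\<eta> / C \<le> T - t"
      using \<epsilon>(1) C(2) t by (auto simp: A_def field_simps)
    then have xy: "\<bar>x\<bar> \<le> A" "\<bar>y\<bar> \<le> A" "t \<le> T - \<eta> / C" using barrier_ge(2)[of x y] barrier_ge(3)[of y x] by auto
    moreover have "\<tau> \<le> t"
    proof (rule ccontr)
      assume "\<not> \<tau> \<le> t"
      then show False using \<tau>(2)[of t y x] t xy \<open>w (x, y, t) \<ge> \<delta> / 2\<close> by simp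
    qed
    ultimately show ?thesis by (auto simp: K_def)
  qed
  have K: "compact K" unfolding K_def by (intro compact_Times compact_Icc)
  have KS: "K \<subseteq> slab T" using \<tau>(1) divide_pos_pos[OF \<eta>(1) C(2)] by (auto simp: K_def)
  have "continuous_on K G"
    unfolding G_def split_beta barrier_def using KS
    by (intro continuous_intros continuous_on_compose2[OF w]) (auto simp: slab_def)
  moreover have z1K: "z1 \<in> K" using inK[of x1 y1 t1] pos(1) G1 z1 by simp
  ultimately obtain z0 where z0: "z0 \<in> K" "\<And>z. z \<in> K \<Longrightarrow> G z \<le> G z0"
    using continuous_attains_sup[OF K] by blast
  have M: "G z0 \<ge> \<delta> / 2" using z0(2)[OF z1K] G1 by simp
  have max: "G z \<le> G z0" if "z \<in> slab T" for z
    using z0(2)[of z] inK M that by (cases z) force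
  \<comment> \<open>Multiplication by \<open>exp (\<kappa> * t)\<close> turns the maximality of
    \<open>G z0\<close> into touching from above, with \<open>M = G z0\<close>.\<close>
  have exp_eq: "(exp (- \<kappa> * t) * W - B - E \<le> N) = (W \<le> exp (\<kappa> * t) * (N + B + E))"
    "(exp (- \<kappa> * t) * W - B - E = N) = (W = exp (\<kappa> * t) * (N + B + E))" for t W B E N :: real
    by (auto simp: exp_minus field_simps)
  show thesis
  proof (rule that[OF \<epsilon>(1) \<eta>(1), of "G z0" z0])
    show "G z0 > 0" using M \<delta> by simp
    show "z0 \<in> slab T" using z0(1) KS by blast
    have "w (x, y, t) \<le> exp (\<kappa> * t) * (G z0 + \<epsilon> * barrier x y + \<eta> / (T - t))"
      if "(x, y, t) \<in> slab T" for x y t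
      using max[OF that] exp_eq(1) by (simp add: G_def)
    then show "\<forall>x y t. (x, y, t) \<in> slab T \<longrightarrow>
        w (x, y, t) \<le> exp (\<kappa> * t) * (G z0 + \<epsilon> * barrier x y + \<eta> / (T - t))" by blast
    have "w z0 = exp (\<kappa> * t) * (G z0 + \<epsilon> * barrier x y + \<eta> / (T - t))"
      if "z0 = (x, y, t)" for x y t
      using exp_eq(2)[of t "w (x, y, t)" "\<epsilon> * barrier x y" "\<eta> / (T - t)" "G z0"] that
      by (simp add: G_def)
    then show "\<forall>x y t. z0 = (x, y, t) \<longrightarrow>
        w z0 = exp (\<kappa> * t) * (G z0 + \<epsilon> * barrier x y + \<eta> / (T - t))" by blast
  qed
qed

section \<open>The comparison principle\<close>

theorem lemma4p1:
  fixes \<sigma> \<nu> \<mu> r m T :: real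
    and v1 v2 v1x v2x :: "real \<times> real \<times> real \<Rightarrow> real"
  assumes "\<sigma> > 0" "\<nu> > 0" "\<mu> > 0" "r > 0" "m > 0" "T > 0" and "\<mu> > r"
    and "v1 \<in> Linfty (Q T) \<inter> (\<Inter>p\<in>{1<..}. W21_loc p (Q T))"
    and "v2 \<in> Linfty (Q T) \<inter> (\<Inter>p\<in>{1<..}. W21_loc p (Q T))"
    and "continuous_on (Q T) v1" "continuous_on (Q T) v2"
    and "cont_rep (Q T) (wderiv (Q T) [ex] v1) v1x"
    and "cont_rep (Q T) (wderiv (Q T) [ex] v2) v2x"
    and "initial_cond \<nu> v1" "initial_cond \<nu> v2"
    and "AE z in lebesgue_on (Q T). Fop \<sigma> \<nu> \<mu> r m T v1 z \<ge> Fop \<sigma> \<nu> \<mu> r m T v2 z"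
    and "\<forall>z\<in>Q T. max (v1x z) (v2x z) \<ge> 0"
  shows "\<forall>z\<in>Q T. v1 z \<ge> v2 z"
proof -
  have c1: "continuous_on (slab T) v1" and c2: "continuous_on (slab T) v2"
    using assms(10,11) slab_subset_Q by (auto intro: continuous_on_subset)
  have cx1: "continuous_on (slab T) v1x" and cx2: "continuous_on (slab T) v2x"
    using assms(12,13) slab_subset_Q by (auto simp: cont_rep_def intro: continuous_on_subset)
  obtain C1 where C1: "C1 > 0" "\<And>z. z \<in> slab T \<Longrightarrow> \<bar>v1 z\<bar> \<le> C1"
    using Linfty_bounded_slab[of v1] assms(8,10) by blast
  obtain C2 where C2: "C2 > 0" "\<And>z. z \<in> slab T \<Longrightarrow> \<bar>v2 z\<bar> \<le> C2"
    using Linfty_bounded_slab[of v2] assms(9,11) by blast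
  define C where "C = C1 + C2"
  have C: "C > 0" "\<And>z. z \<in> slab T \<Longrightarrow> \<bar>v1 z\<bar> \<le> C" "\<And>z. z \<in> slab T \<Longrightarrow> \<bar>v2 z\<bar> \<le> C"
    "\<And>z. z \<in> slab T \<Longrightarrow> v2 z - v1 z \<le> C"
  proof -
    show "C > 0" using C1(1) C2(1) by (simp add: C_def)
    fix z assume "z \<in> slab T"
    from C1(2)[OF this] C2(2)[OF this]
    show "\<bar>v1 z\<bar> \<le> C" "\<bar>v2 z\<bar> \<le> C" "v2 z - v1 z \<le> C"
      using C1(1) C2(1) unfolding C_def by linarith+
  qed
  let ?g = "wderiv (Q T)"
  have weak: "has_weak_deriv (Q T) ds v (?g ds v)"
    if "v \<in> (\<Inter>p\<in>{1<..}. W21_loc p (Q T))" "ds \<in> {[ex], [ey], [ex, ex], [ey, ey], [et]}" for v ds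
  proof -
    have "v \<in> W21_loc 2 (Q T)" using that(1) by auto
    then have "\<exists>g. has_weak_deriv (Q T) ds v g" using that(2) by (auto simp: W21_loc_def)
    then show ?thesis unfolding wderiv_def by (rule someI_ex)
  qed
  have weak1: "has_weak_deriv (Q T) ds v1 (?g ds v1)" and weak2: "has_weak_deriv (Q T) ds v2 (?g ds v2)"
    if "ds \<in> {[ex], [ey], [ex, ex], [ey, ey], [et]}" for ds
    using weak[OF _ that] assms(8,9) by blast+
  define w where "w = (\<lambda>z. v2 z - v1 z)"
  define a where "a = \<sigma>\<^sup>2 / 2"
  define b where "b = \<nu>\<^sup>2 / 2"
  define c where "c = \<mu> + 1 / 2 * \<sigma>\<^sup>2"
  define D where "D = C / m"
  have pos: "a \<ge> 0" "b \<ge> 0" "c \<ge> 0" "D \<ge> 0"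
    using assms(3,5) C(1) by (auto simp: a_def b_def c_def D_def)
  \<comment> \<open>The part \<open>\<mu> - r\<close> pays for the zero-order term and the bracket
    for the constant of \<open>barrier_supersolution\<close>.\<close>
  define \<kappa> where "\<kappa> = \<mu> - r + (4 * a + b + 2 * c + D) + 1"
  have \<kappa>: "\<kappa> \<ge> 0" using assms(7) pos by (simp add: \<kappa>_def)
  define p where "p = (\<lambda>z. v2x z - v1x z)"
  define F where "F = (\<lambda>z. (\<mu> - r) * w z - exp (fst (snd z)) / m * (v2 z * v2x z - v1 z * v1x z))"
  have wc: "continuous_on (slab T) w" and pc: "continuous_on (slab T) p" and Fc: "continuous_on (slab T) F"
    unfolding w_def p_def F_def by (intro continuous_intros c1 c2 cx1 cx2; use assms(5) in simp)+
  \<comment> \<open>Both functions are close to the same initial profile, uniformly in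
    \<open>x\<close>, so their difference is small.\<close>
  have init: "\<exists>\<tau>>0. \<forall>x y t. 0 < t \<longrightarrow> t < \<tau> \<longrightarrow> t < T \<longrightarrow> \<bar>y\<bar> \<le> A \<longrightarrow> w (x, y, t) < \<gamma>"
    if A: "A > 0" "\<gamma> > 0" for A \<gamma>
  proof -
    have g: "\<gamma> / 2 > 0" using A by simp
    obtain \<tau>1 where 1: "\<tau>1 > 0" "\<And>x y t. 0 < t \<Longrightarrow> t < \<tau>1 \<Longrightarrow> t < T \<Longrightarrow> \<bar>y\<bar> \<le> A \<Longrightarrow>
        \<bar>v1 (x, y, t) - ncdf (x / (\<nu> * sqrt t))\<bar> < \<gamma> / 2"
      using initial_cond_small[OF assms(14) C(2) assms(6) A(1) g] by blast
    obtain \<tau>2 where 2: "\<tau>2 > 0" "\<And>x y t. 0 < t \<Longrightarrow> t < \<tau>2 \<Longrightarrow> t < T \<Longrightarrow> \<bar>y\<bar> \<le> A \<Longrightarrow>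
        \<bar>v2 (x, y, t) - ncdf (x / (\<nu> * sqrt t))\<bar> < \<gamma> / 2"
      using initial_cond_small[OF assms(15) C(3) assms(6) A(1) g] by blast
    have "w (x, y, t) < \<gamma>" if "0 < t" "t < min \<tau>1 \<tau>2" "t < T" "\<bar>y\<bar> \<le> A" for x y t
    proof -
      have "\<bar>v1 (x, y, t) - ncdf (x / (\<nu> * sqrt t))\<bar> < \<gamma> / 2"
        "\<bar>v2 (x, y, t) - ncdf (x / (\<nu> * sqrt t))\<bar> < \<gamma> / 2" using 1(2) 2(2) that by auto
      then show ?thesis unfolding w_def by linarith
    qed
    then show ?thesis using 1(1) 2(1) by (intro exI[of _ "min \<tau>1 \<tau>2"]) auto
  qed
  have slab_le: "w z \<le> 0" if z: "z \<in> slab T" for z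
  proof (rule ccontr)
    assume "\<not> w z \<le> 0"
    then have wzp: "w z > 0" by simp
    have wC: "w z \<le> C" if "z \<in> slab T" for z using C(4)[OF that] by (simp add: w_def)
    obtain \<epsilon> \<eta> M z0 where e: "\<epsilon> > 0" "\<eta> > 0" "M > 0" and z0: "z0 \<in> slab T"
      and le: "\<forall>x y t. (x, y, t) \<in> slab T \<longrightarrow> w (x, y, t) \<le> exp (\<kappa> * t) * (M + \<epsilon> * barrier x y + \<eta> / (T - t))"
      and eq: "\<forall>x y t. z0 = (x, y, t) \<longrightarrow> w z0 = exp (\<kappa> * t) * (M + \<epsilon> * barrier x y + \<eta> / (T - t))"
      by (rule penalized_max_exists[OF wc wC C(1) init z wzp \<kappa>]) blast
    obtain x0 y0 t0 where z0e: "z0 = (x0, y0, t0)" by (cases z0)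
    have t0: "0 < t0" "t0 < T" using z0 z0e by auto
    define B where "B = barrier x0 y0"
    have B: "B \<ge> 2" unfolding B_def by (rule barrier_ge)
    define Y where "Y = M + \<epsilon> * B + \<eta> / (T - t0)"
    have Y: "Y > 0" "Y \<ge> \<epsilon> * B" using e t0 B by (auto simp: Y_def intro!: add_pos_pos)
    define E where "E = exp (\<kappa> * t0)"
    have E: "E > 0" by (simp add: E_def)
    have wz0: "w z0 = E * Y" using eq[rule_format, OF z0e] by (simp add: E_def Y_def B_def)
    have wz0p: "w z0 > 0" using wz0 E Y by simp
    \<comment> \<open>The quartic and quadratic terms make the touching strict; all their derivatives
      that enter the operator vanish at \<open>z0\<close>.\<close>
    define \<psi> :: "pt \<Rightarrow> real" where "\<psi> = (\<lambda>(x, y, t). exp (\<kappa> * t) * (M + \<epsilon> * barrier x y + \<eta> / (T - t))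
      + ((x - x0) ^ 4 + (y - y0) ^ 4 + (t - t0) ^ 2))"
    define \<psi>x :: "pt \<Rightarrow> real" where "\<psi>x = (\<lambda>(x, y, t). exp (\<kappa> * t) * (\<epsilon> * (2 * x)) + 4 * (x - x0) ^ 3)"
    define \<psi>xx :: "pt \<Rightarrow> real" where "\<psi>xx = (\<lambda>(x, y, t). exp (\<kappa> * t) * (\<epsilon> * 2) + 12 * (x - x0) ^ 2)"
    define \<psi>y :: "pt \<Rightarrow> real" where "\<psi>y = (\<lambda>(x, y, t). exp (\<kappa> * t) * (\<epsilon> * (2 * (exp (2 * y) - exp (- 2 * y))))
      + 4 * (y - y0) ^ 3)"
    define \<psi>yy :: "pt \<Rightarrow> real" where "\<psi>yy = (\<lambda>(x, y, t). exp (\<kappa> * t) * (\<epsilon> * (4 * (exp (2 * y) + exp (- 2 * y))))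
      + 12 * (y - y0) ^ 2)"
    define \<psi>t :: "pt \<Rightarrow> real" where "\<psi>t = (\<lambda>(x, y, t). \<kappa> * exp (\<kappa> * t) * (M + \<epsilon> * barrier x y + \<eta> / (T - t))
      + exp (\<kappa> * t) * (\<eta> / (T - t) ^ 2) + 2 * (t - t0))"
    \<comment> \<open>The box is taken inside the set where \<open>w\<close> is positive, since only
      there is the obstacle inactive for \<open>v1\<close>.\<close>
    have oW: "open (slab T \<inter> w -` {0<..})"
      by (intro continuous_open_preimage wc open_slab) auto
    have "z0 \<in> slab T \<inter> w -` {0<..}" using wz0p z0 by simp
    from open_contains_cbox[OF oW this] obtain l u where lu: "z0 \<in> box l u" "cbox l u \<subseteq> slab T \<inter> w -` {0<..}"
      by metis
    have bs: "z \<in> slab T" if "z \<in> box l u" for z using that lu(2) box_subset_cbox by blast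
    have T: "t < T" if "(x, y, t) \<in> box l u" for x y t using bs[OF that] by simp
    have touch: "p z0 = \<psi>x z0 \<and> \<psi>t z0 - a * \<psi>yy z0 - b * \<psi>xx z0 - c * \<psi>y z0 \<le> F z0"
    proof (rule strict_touching[where \<psi> = \<psi> and w = w and l = l and u = u])
      show "0 \<le> a" "0 \<le> b" "z0 \<in> box l u" by (fact pos lu(1))+
      show "continuous_on (cbox l u) w" "continuous_on (cbox l u) p" "continuous_on (cbox l u) F"
        using wc pc Fc lu(2) by (auto intro: continuous_on_subset)
      have ne: "T - snd (snd z) \<noteq> 0" if "z \<in> box l u" for z using T that by (cases z) force
      show "continuous_on (box l u) \<psi>" "continuous_on (box l u) \<psi>x"
        "continuous_on (box l u) (\<lambda>z. \<psi>t z - a * \<psi>yy z - b * \<psi>xx z - c * \<psi>y z)"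
        unfolding \<psi>_def \<psi>x_def \<psi>xx_def \<psi>y_def \<psi>yy_def \<psi>t_def barrier_def split_beta
        by (intro continuous_intros; use ne in simp)+
      show "((\<lambda>s. \<psi> (s, y, t)) has_real_derivative \<psi>x (x, y, t)) (at x) \<and>
        ((\<lambda>s. \<psi>x (s, y, t)) has_real_derivative \<psi>xx (x, y, t)) (at x) \<and>
        ((\<lambda>s. \<psi> (x, s, t)) has_real_derivative \<psi>y (x, y, t)) (at y) \<and>
        ((\<lambda>s. \<psi>y (x, s, t)) has_real_derivative \<psi>yy (x, y, t)) (at y) \<and>
        ((\<lambda>s. \<psi> (x, y, s)) has_real_derivative \<psi>t (x, y, t)) (at t)"
        if "(x, y, t) \<in> box l u" for x y t
        unfolding \<psi>_def \<psi>x_def \<psi>xx_def \<psi>y_def \<psi>yy_def \<psi>t_def barrier_def using T[OF that]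
        by (intro conjI; auto intro!: derivative_eq_intros simp: power2_eq_square; simp add: algebra_simps)
      show "w z - \<psi> z < w z0 - \<psi> z0" if "z \<in> box l u" "z \<noteq> z0" for z
      proof -
        obtain x y t where z: "z = (x, y, t)" by (cases z)
        have "x - x0 \<noteq> 0 \<or> y - y0 \<noteq> 0 \<or> t - t0 \<noteq> 0" using that(2) by (auto simp: z z0e)
        moreover have "0 \<le> (x - x0) ^ 4" "0 \<le> (y - y0) ^ 4" "0 \<le> (t - t0) ^ 2" by auto
        moreover have "x - x0 \<noteq> 0 \<Longrightarrow> 0 < (x - x0) ^ 4" "y - y0 \<noteq> 0 \<Longrightarrow> 0 < (y - y0) ^ 4"
          "t - t0 \<noteq> 0 \<Longrightarrow> 0 < (t - t0) ^ 2" by (auto simp: zero_less_power_eq)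
        ultimately have "0 < (x - x0) ^ 4 + (y - y0) ^ 4 + (t - t0) ^ 2" by linarith
        moreover have "w z \<le> exp (\<kappa> * t) * (M + \<epsilon> * barrier x y + \<eta> / (T - t))"
          using le bs[OF that(1)] z by simp
        moreover have "\<psi> z0 = w z0" using eq[rule_format, OF z0e] by (simp add: \<psi>_def z0e)
        ultimately show ?thesis by (simp add: \<psi>_def z)
      qed
      have lu': "cbox l u \<subseteq> interior (Q T)" using lu(2) slab_subset_interior_Q by blast
      have ae1: "AE z in lebesgue_on (interior (Q T)). v1x z = ?g [ex] v1 z"
        and ae2: "AE z in lebesgue_on (interior (Q T)). v2x z = ?g [ex] v2 z"
        using assms(12,13) by (auto simp: cont_rep_def intro: AE_interior_Q)
      have aeF: "AE z in lebesgue_on (interior (Q T)). Fop \<sigma> \<nu> \<mu> r m T v1 z \<ge> Fop \<sigma> \<nu> \<mu> r m T v2 z"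
        by (rule AE_interior_Q[OF assms(16)])
      have pae: "AE z in lebesgue_on (interior (Q T)). z \<in> cbox l u \<longrightarrow> ?g [ex] v2 z - ?g [ex] v1 z = p z"
        using ae1 ae2 by eventually_elim (simp add: p_def)
      have Fae: "AE z in lebesgue_on (interior (Q T)). z \<in> cbox l u \<longrightarrow>
        ?g [et] v2 z - ?g [et] v1 z - a * (?g [ey, ey] v2 z - ?g [ey, ey] v1 z)
          - b * (?g [ex, ex] v2 z - ?g [ex, ex] v1 z) - c * (?g [ey] v2 z - ?g [ey] v1 z) \<le> F z"
        using ae1 ae2 aeF
      proof eventually_elim
        case (elim z)
        show ?case
        proof
          assume "z \<in> cbox l u"
          then have wz: "v1 z < v2 z" using lu(2) by (auto simp: w_def)
          obtain x y t where z: "z = (x, y, t)" by (cases z)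
          \<comment> \<open>If the maximum for \<open>v1\<close> were \<open>v1 z - 1\<close>, it
            would be below \<open>v2 z - 1\<close> and hence below the value of the operator at
            \<open>v2\<close>. So the differential part is the maximum for \<open>v1\<close>, and it
            dominates the one for \<open>v2\<close>.\<close>
          have "Lop \<sigma> \<nu> \<mu> r T v2 z + exp y / m * v2 z * ?g [ex] v2 z
              \<le> Lop \<sigma> \<nu> \<mu> r T v1 z + exp y / m * v1 z * ?g [ex] v1 z"
            using elim(3) wz by (auto simp: Fop_def z max_def split: if_splits)
          then show "?g [et] v2 z - ?g [et] v1 z - a * (?g [ey, ey] v2 z - ?g [ey, ey] v1 z)
            - b * (?g [ex, ex] v2 z - ?g [ex, ex] v1 z) - c * (?g [ey] v2 z - ?g [ey] v1 z) \<le> F z"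
            using elim(1,2) unfolding Lop_def a_def[symmetric] b_def[symmetric] c_def[symmetric]
            by (simp add: F_def w_def z algebra_simps)
        qed
      qed
      have cw: "continuous_on (cbox l u) (\<lambda>z. v2 z - v1 z)" and cp: "continuous_on (cbox l u) p"
        and cF: "continuous_on (cbox l u) F"
        using wc pc Fc lu(2) unfolding w_def by (auto intro: continuous_on_subset)
      show "conv d l u p 0 0 0 z = - conv d l u w 1 0 0 z \<and>
        - conv d l u w 0 0 1 z - a * conv d l u w 0 2 0 z - b * conv d l u w 2 0 0 z
          + c * conv d l u w 0 1 0 z \<le> conv d l u F 0 0 0 z"
        if "bump h d" "cube h z \<subseteq> cbox l u" for h d z
        using weak_differential_inequality[OF lu' weak1 weak2 cw cp cF pae Fae that]
        unfolding w_def by blast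
    qed
    have px: "p z0 = E * \<epsilon> * (2 * x0)" using touch by (simp add: \<psi>x_def z0e E_def)
    have z0Q: "z0 \<in> Q T" using z0 slab_subset_Q by blast
    \<comment> \<open>The difference of products is split so that the nonnegative
      \<open>x\<close>-derivative multiplies \<open>w z0 > 0\<close>; the rest is bounded by
      \<open>C * \<bar>p z0\<bar>\<close>.\<close>
    have conv: "- (C * \<bar>p z0\<bar>) \<le> v2 z0 * v2x z0 - v1 z0 * v1x z0"
    proof (cases "v2x z0 \<ge> 0")
      case True
      have "v2 z0 * v2x z0 - v1 z0 * v1x z0 = w z0 * v2x z0 + v1 z0 * p z0"
        by (simp add: w_def p_def algebra_simps)
      moreover have "w z0 * v2x z0 \<ge> 0" using True wz0p by simp
      moreover have "\<bar>v1 z0 * p z0\<bar> \<le> C * \<bar>p z0\<bar>"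
        using C(2)[OF z0] by (simp add: abs_mult mult_right_mono)
      ultimately show ?thesis by linarith
    next
      case False
      then have "v1x z0 \<ge> 0" using assms(17) z0Q by (auto simp: max_def split: if_splits)
      have "v2 z0 * v2x z0 - v1 z0 * v1x z0 = w z0 * v1x z0 + v2 z0 * p z0"
        by (simp add: w_def p_def algebra_simps)
      moreover have "w z0 * v1x z0 \<ge> 0" using \<open>v1x z0 \<ge> 0\<close> wz0p by simp
      moreover have "\<bar>v2 z0 * p z0\<bar> \<le> C * \<bar>p z0\<bar>"
        using C(3)[OF z0] by (simp add: abs_mult mult_right_mono)
      ultimately show ?thesis by linarith
    qed
    have Fz0: "F z0 = (\<mu> - r) * (E * Y) - exp y0 / m * (v2 z0 * v2x z0 - v1 z0 * v1x z0)"
      unfolding F_def wz0 by (simp add: z0e)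
    have "exp y0 / m * (v2 z0 * v2x z0 - v1 z0 * v1x z0) \<ge> exp y0 / m * (- (C * \<bar>p z0\<bar>))"
      using conv assms(5) by (intro mult_left_mono) auto
    moreover have "exp y0 / m * (- (C * \<bar>p z0\<bar>)) = - (E * \<epsilon> * (D * (exp y0 * (2 * \<bar>x0\<bar>))))"
      using E e(1) by (simp add: px D_def abs_mult)
    ultimately have "F z0 \<le> (\<mu> - r) * (E * Y) + E * \<epsilon> * (D * (exp y0 * (2 * \<bar>x0\<bar>)))"
      unfolding Fz0 by linarith
    moreover have "\<psi>t z0 - a * \<psi>yy z0 - b * \<psi>xx z0 - c * \<psi>y z0
      = \<kappa> * (E * Y) + E * (\<eta> / (T - t0) ^ 2) - E * \<epsilon> * (a * (4 * (exp (2 * y0) + exp (- 2 * y0))) + b * 2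
          + c * (2 * (exp (2 * y0) - exp (- 2 * y0))))"
      by (simp add: \<psi>t_def \<psi>yy_def \<psi>xx_def \<psi>y_def z0e E_def Y_def B_def algebra_simps)
    moreover have "E * (\<eta> / (T - t0) ^ 2) > 0" using E e t0 by simp
    moreover have "E * \<epsilon> * (a * (4 * (exp (2 * y0) + exp (- 2 * y0))) + b * 2
          + c * (2 * (exp (2 * y0) - exp (- 2 * y0))) + D * (exp y0 * (2 * \<bar>x0\<bar>)))
        \<le> E * \<epsilon> * ((4 * a + b + 2 * c + D) * B)"
      using barrier_supersolution[OF pos, of y0 x0] E e(1) unfolding B_def by (intro mult_left_mono) auto
    \<comment> \<open>The strict inequality comes from the positive time derivative of
      \<open>\<eta> / (T - t)\<close>.\<close>
    ultimately have "\<kappa> * (E * Y) < (\<mu> - r) * (E * Y) + E * \<epsilon> * ((4 * a + b + 2 * c + D) * B)"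
      using touch by (simp add: algebra_simps)
    also have "\<dots> = (\<mu> - r) * (E * Y) + (4 * a + b + 2 * c + D) * (E * (\<epsilon> * B))" by simp
    \<comment> \<open>Since \<open>\<epsilon> * B \<le> Y\<close>, the barrier terms are controlled
      by the touching value \<open>E * Y\<close>.\<close>
    also have "\<dots> \<le> (\<mu> - r) * (E * Y) + (4 * a + b + 2 * c + D) * (E * Y)"
      using Y(2) E pos by (intro add_left_mono mult_left_mono) auto
    also have "\<dots> \<le> \<kappa> * (E * Y)"
      using E Y(1) by (simp add: \<kappa>_def algebra_simps)
    finally show False by simp
  qed
  show ?thesis
  proof
    fix z assume z: "z \<in> Q T"
    obtain x y t where ze: "z = (x, y, t)" by (cases z)
    have t: "0 < t" "t \<le> T" using z by (auto simp: Q_def ze)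
    have "continuous_on {0<..T} (\<lambda>s. v1 (x, y, s) - v2 (x, y, s))"
      by (intro continuous_intros continuous_on_compose2[OF assms(10)] continuous_on_compose2[OF assms(11)])
        (auto simp: Q_def)
    then have "((\<lambda>s. v1 (x, y, s) - v2 (x, y, s)) \<longlongrightarrow> v1 z - v2 z) (at t within {0<..T})"
      using t by (simp add: continuous_on_def ze)
    \<comment> \<open>Approaching \<open>t\<close> from below stays in the slab even for
      \<open>t = T\<close>.\<close>
    then have lim: "((\<lambda>s. v1 (x, y, s) - v2 (x, y, s)) \<longlongrightarrow> v1 z - v2 z) (at t within {0<..<t})"
      by (rule tendsto_within_subset) (use t in auto)
    have "\<forall>\<^sub>F s in at t within {0<..<t}. 0 \<le> v1 (x, y, s) - v2 (x, y, s)"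
      using slab_le t by (auto simp: eventually_at_filter w_def intro!: always_eventually)
    moreover have "at t within {0<..<t} \<noteq> bot"
      using t by (simp add: at_within_eq_bot_iff)
    ultimately have "0 \<le> v1 z - v2 z"
      using lim tendsto_lowerbound by blast
    then show "v2 z \<le> v1 z" by simp
  qed
qed

end
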